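(* Let $\phi$ be a first-order formula over the vocabulary $\{\subseteq,\preceq\}$. Then $\textsc{Eval}(\phi)$ is in $\mathrm{P}$.
   Context: A partial instance of dimension $n$ is a tuple in $\{0,1,\bot\}^n$; write $\mathbf{e}_\bot=\{i\mid\mathbf{e}[i]=\bot\}$. For a decision tree $\mathcal{T}$ of dimension $n$ (a rooted binary tree with internal nodes labeled by features in $\{1,\dots,n\}$, edges labeled $0/1$, leaves labeled $\mathsf{true}/\mathsf{false}$, no feature repeated on a root-to-leaf path), formulas over $\{\subseteq,\preceq\}$ are interpreted over the domain $\{0,1,\bot\}^n$ where $\mathbf{e}_1\subseteq\mathbf{e}_2$ iff $\mathbf{e}_1[i]=\mathbf{e}_2[i]$ for every $i$ with $\mathbf{e}_1[i]\neq\bot$ (subsumption), and $\mathbf{e}\preceq\mathbf{e}'$ iff $|\mathbf{e}_\bot|\ge|\mathbf{e}'_\bot|$. For a fixed formula $\phi(x_1,\dots,x_k)$, $\textsc{Eval}(\phi)$ takes as input a decision tree $\mathcal{T}$ of dimension $n$ and partial instances $\mathbf{e}_1,\dots,\mathbf{e}_k$ of dimension $n$ and asks whether $\mathcal{T}\models\phi(\mathbf{e}_1,\dots,\mathbf{e}_k)$. *)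

theory Defs
  imports "HOL-Computational_Algebra.Polynomial"
begin

section \<open>Deterministic multi-tape Turing machines and the class P\<close>

text \<open>
  A machine has finitely many two-way infinite tapes.  Tape symbols are the blank, the letters of
  the input alphabet \<^typ>\<open>'a\<close>, and auxiliary symbols; the tape alphabet of a machine is a finite
  set of such symbols.
\<close>

datatype 'a cell = Blank | Input 'a | Work nat

datatype move = MoveLeft | MoveRight | Stay

record 'a tm =
  tm_tapes :: nat
  tm_states :: "nat set"
  tm_alphabet :: "'a cell set"
  tm_start :: nat
  tm_accept :: nat
  tm_reject :: nat
  tm_delta :: "nat \<Rightarrow> 'a cell list \<Rightarrow> nat \<times> ('a cell \<times> move) list"

definition turing_machine :: "'a::finite tm \<Rightarrow> bool" where
  "turing_machine M \<longleftrightarrow>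
     tm_tapes M \<ge> 1 \<and>
     finite (tm_states M) \<and>
     finite (tm_alphabet M) \<and>
     insert Blank (range Input) \<subseteq> tm_alphabet M \<and>
     {tm_start M, tm_accept M, tm_reject M} \<subseteq> tm_states M \<and>
     tm_accept M \<noteq> tm_reject M \<and>
     (\<forall>q \<in> tm_states M - {tm_accept M, tm_reject M}.
        \<forall>ss. length ss = tm_tapes M \<and> set ss \<subseteq> tm_alphabet M \<longrightarrow>
          fst (tm_delta M q ss) \<in> tm_states M \<and>
          length (snd (tm_delta M q ss)) = tm_tapes M \<and>
          fst ` set (snd (tm_delta M q ss)) \<subseteq> tm_alphabet M)"

text \<open>A tape is its contents together with the head position.\<close>

type_synonym 'a tape = "(int \<Rightarrow> 'a cell) \<times> int"

type_synonym 'a config = "nat \<times> 'a tape list"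

definition tape_read :: "'a tape \<Rightarrow> 'a cell" where
  "tape_read tp = fst tp (snd tp)"

fun head_shift :: "move \<Rightarrow> int" where
  "head_shift MoveLeft = -1"
| "head_shift MoveRight = 1"
| "head_shift Stay = 0"

fun tape_act :: "'a cell \<times> move \<Rightarrow> 'a tape \<Rightarrow> 'a tape" where
  "tape_act (s, m) (c, h) = (c(h := s), h + head_shift m)"

definition tm_step :: "'a tm \<Rightarrow> 'a config \<Rightarrow> 'a config" where
  "tm_step M cf =
     (case cf of (q, tps) \<Rightarrow>
        if q = tm_accept M \<or> q = tm_reject M then (q, tps)
        else (case tm_delta M q (map tape_read tps) of
                (q', acts) \<Rightarrow> (q', map2 tape_act acts tps)))"

definition blank_tape :: "'a tape" where
  "blank_tape = (\<lambda>_. Blank, 0)"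

definition input_tape :: "'a list \<Rightarrow> 'a tape" where
  "input_tape w =
     (\<lambda>i. if 0 \<le> i \<and> i < int (length w) then Input (w ! nat i) else Blank, 0)"

definition tm_initial :: "'a tm \<Rightarrow> 'a list \<Rightarrow> 'a config" where
  "tm_initial M w = (tm_start M, input_tape w # replicate (tm_tapes M - 1) blank_tape)"

definition decides_in_time :: "'a tm \<Rightarrow> 'a list set \<Rightarrow> (nat \<Rightarrow> nat) \<Rightarrow> bool" where
  "decides_in_time M A f \<longleftrightarrow>
     (\<forall>w. \<exists>s \<le> f (length w).
        fst ((tm_step M ^^ s) (tm_initial M w)) =
          (if w \<in> A then tm_accept M else tm_reject M))"

definition PTIME :: "'a::finite list set set" where
  "PTIME = {A. \<exists>M. turing_machine M \<and> (\<exists>p :: nat poly. decides_in_time M A (poly p))}"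


section \<open>Partial instances\<close>

text \<open>
  \<^term>\<open>None\<close> is the undefined value; coordinate \<open>i \<in> {1..n}\<close> is stored at list position \<open>i - 1\<close>.
\<close>

type_synonym pinst = "bool option list"

definition pinsts :: "nat \<Rightarrow> pinst set" where
  "pinsts n = {e. length e = n}"

definition undef_coords :: "pinst \<Rightarrow> nat set" where
  "undef_coords e = {i. i < length e \<and> e ! i = None}"

definition subsumed :: "pinst \<Rightarrow> pinst \<Rightarrow> bool" where
  "subsumed e1 e2 \<longleftrightarrow> (\<forall>i < length e1. e1 ! i \<noteq> None \<longrightarrow> e1 ! i = e2 ! i)"

definition less_defined :: "pinst \<Rightarrow> pinst \<Rightarrow> bool" where
  "less_defined e1 e2 \<longleftrightarrow> card (undef_coords e1) \<ge> card (undef_coords e2)"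


section \<open>Decision trees\<close>

text \<open>In \<open>Node i t0 t1\<close> the edges to \<open>t0\<close> and \<open>t1\<close> are labeled 0 and 1.\<close>

datatype btree = Leaf bool | Node nat btree btree

fun features :: "btree \<Rightarrow> nat set" where
  "features (Leaf b) = {}"
| "features (Node i t0 t1) = insert i (features t0 \<union> features t1)"

text \<open>The sequences of features read along the root-to-leaf paths.\<close>

fun paths :: "btree \<Rightarrow> nat list set" where
  "paths (Leaf b) = {[]}"
| "paths (Node i t0 t1) = (\<lambda>p. i # p) ` (paths t0 \<union> paths t1)"

record dtree =
  dt_dim :: nat
  dt_tree :: btree

definition decision_tree :: "dtree \<Rightarrow> bool" where
  "decision_tree T \<longleftrightarrow>
     features (dt_tree T) \<subseteq> {1..dt_dim T} \<and> (\<forall>p \<in> paths (dt_tree T). distinct p)"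


section \<open>First-order logic over subsumption and the cardinality preorder\<close>

datatype fo =
    Subs nat nat
  | Prec nat nat
  | Equal nat nat
  | Neg fo
  | Conj fo fo
  | Disj fo fo
  | Exists nat fo
  | Forall nat fo

fun free_vars :: "fo \<Rightarrow> nat set" where
  "free_vars (Subs x y) = {x, y}"
| "free_vars (Prec x y) = {x, y}"
| "free_vars (Equal x y) = {x, y}"
| "free_vars (Neg \<phi>) = free_vars \<phi>"
| "free_vars (Conj \<phi> \<psi>) = free_vars \<phi> \<union> free_vars \<psi>"
| "free_vars (Disj \<phi> \<psi>) = free_vars \<phi> \<union> free_vars \<psi>"
| "free_vars (Exists x \<phi>) = free_vars \<phi> - {x}"
| "free_vars (Forall x \<phi>) = free_vars \<phi> - {x}"

fun sat :: "dtree \<Rightarrow> (nat \<Rightarrow> pinst) \<Rightarrow> fo \<Rightarrow> bool" where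
  "sat T \<sigma> (Subs x y) \<longleftrightarrow> subsumed (\<sigma> x) (\<sigma> y)"
| "sat T \<sigma> (Prec x y) \<longleftrightarrow> less_defined (\<sigma> x) (\<sigma> y)"
| "sat T \<sigma> (Equal x y) \<longleftrightarrow> \<sigma> x = \<sigma> y"
| "sat T \<sigma> (Neg \<phi>) \<longleftrightarrow> \<not> sat T \<sigma> \<phi>"
| "sat T \<sigma> (Conj \<phi> \<psi>) \<longleftrightarrow> sat T \<sigma> \<phi> \<and> sat T \<sigma> \<psi>"
| "sat T \<sigma> (Disj \<phi> \<psi>) \<longleftrightarrow> sat T \<sigma> \<phi> \<or> sat T \<sigma> \<psi>"
| "sat T \<sigma> (Exists x \<phi>) \<longleftrightarrow> (\<exists>e \<in> pinsts (dt_dim T). sat T (\<sigma>(x := e)) \<phi>)"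
| "sat T \<sigma> (Forall x \<phi>) \<longleftrightarrow> (\<forall>e \<in> pinsts (dt_dim T). sat T (\<sigma>(x := e)) \<phi>)"

text \<open>
  For distinct variables \<open>xs = [x\<^sub>1, \<dots>, x\<^sub>k]\<close> covering the free variables of \<open>\<phi>\<close>,
  \<open>models T \<phi> xs [e\<^sub>1, \<dots>, e\<^sub>k]\<close> is \<open>T \<Turnstile> \<phi>(e\<^sub>1, \<dots>, e\<^sub>k)\<close>.
\<close>

definition models :: "dtree \<Rightarrow> fo \<Rightarrow> nat list \<Rightarrow> pinst list \<Rightarrow> bool" where
  "models T \<phi> xs es \<longleftrightarrow> sat T (\<lambda>x. the (map_of (zip xs es) x)) \<phi>"


section \<open>The evaluation problem as a formal language\<close>

datatype sym = Zero | One | Bot | Tally | Sep | LeafTrue | LeafFalse | Inner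

lemma UNIV_sym: "UNIV = {Zero, One, Bot, Tally, Sep, LeafTrue, LeafFalse, Inner}"
proof -
  have "x \<in> {Zero, One, Bot, Tally, Sep, LeafTrue, LeafFalse, Inner}" for x
    by (cases x) auto
  then show ?thesis by blast
qed

instance sym :: finite
  by standard (simp add: UNIV_sym)

text \<open>
  Trees are written in preorder.  The dimension and the features are written in unary; since
  features are at most the dimension, and a partial instance of dimension \<open>n\<close> occupies \<open>n\<close> letters
  anyway, this makes the length of an input polynomial in \<open>n\<close>, the number of nodes and \<open>k\<close>.
\<close>

fun encode_btree :: "btree \<Rightarrow> sym list" where
  "encode_btree (Leaf b) = [if b then LeafTrue else LeafFalse]"
| "encode_btree (Node i t0 t1) =
     Inner # replicate i Tally @ encode_btree t0 @ encode_btree t1"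

fun encode_value :: "bool option \<Rightarrow> sym" where
  "encode_value None = Bot"
| "encode_value (Some b) = (if b then One else Zero)"

definition encode_pinst :: "pinst \<Rightarrow> sym list" where
  "encode_pinst e = map encode_value e"

definition encode :: "dtree \<Rightarrow> pinst list \<Rightarrow> sym list" where
  "encode T es =
     replicate (dt_dim T) Tally @ Sep # encode_btree (dt_tree T) @
     concat (map (\<lambda>e. Sep # encode_pinst e) es)"

definition Eval :: "fo \<Rightarrow> nat list \<Rightarrow> sym list set" where
  "Eval \<phi> xs =
     {encode T es | T es. decision_tree T \<and> length es = length xs \<and>
        set es \<subseteq> pinsts (dt_dim T) \<and> models T \<phi> xs es}"


subsection \<open>The encoding is injective\<close>

lemma replicate_Tally_append_eq:
  assumes "replicate i Tally @ x # u = replicate j Tally @ y # v" "x \<noteq> Tally" "y \<noteq> Tally"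
  shows "i = j \<and> x # u = y # v"
  using assms(1)
proof (induction i arbitrary: j)
  case 0
  then show ?case using assms by (cases j) auto
next
  case (Suc i)
  then show ?case using assms by (cases j) auto
qed

lemma encode_btree_Cons: "\<exists>x u. encode_btree t = x # u \<and> x \<noteq> Tally"
  by (cases t) auto

lemma encode_btree_append_eq:
  "encode_btree t @ u = encode_btree t' @ u' \<Longrightarrow> t = t' \<and> u = u'"
proof (induction t arbitrary: t' u u')
  case (Leaf b)
  then show ?case by (cases t') (auto split: if_splits)
next
  case (Node i t0 t1)
  obtain j s0 s1 where t': "t' = Node j s0 s1"
    using Node.prems by (cases t') (auto split: if_splits)
  obtain x v where x: "encode_btree t0 = x # v" "x \<noteq> Tally"
    using encode_btree_Cons by blast
  obtain y w where y: "encode_btree s0 = y # w" "y \<noteq> Tally"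
    using encode_btree_Cons by blast
  have "replicate i Tally @ x # (v @ encode_btree t1 @ u) =
        replicate j Tally @ y # (w @ encode_btree s1 @ u')"
    using Node.prems x y t' by simp
  from replicate_Tally_append_eq[OF this x(2) y(2)]
  have "i = j" "encode_btree t0 @ (encode_btree t1 @ u) = encode_btree s0 @ (encode_btree s1 @ u')"
    using x y by auto
  then show ?case using Node.IH(1)[of _ s0] Node.IH(2)[of _ s1] t' by metis
qed

lemma encode_pinsts_eq:
  "concat (map (\<lambda>e. Sep # encode_pinst e) es) = concat (map (\<lambda>e. Sep # encode_pinst e) es') \<Longrightarrow>
   es = es'"
proof (induction es arbitrary: es')
  case Nil
  then show ?case by (cases es') auto
next
  case (Cons e es)
  let ?c = "\<lambda>es. concat (map (\<lambda>e. Sep # encode_pinst e) es)"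
  obtain d ds where es': "es' = d # ds" using Cons.prems by (cases es') auto
  have eq: "encode_pinst e @ ?c es = encode_pinst d @ ?c ds"
    using Cons.prems es' by simp
  have val: "encode_value a \<noteq> Sep" for a by (cases a) auto
  have tw: "takeWhile (\<lambda>x. x \<noteq> Sep) (encode_pinst e @ ?c es) = encode_pinst e" for e es
    by (cases es) (auto simp: encode_pinst_def val takeWhile_append)
  have pe: "encode_pinst e = encode_pinst d" using arg_cong[OF eq, of "takeWhile (\<lambda>x. x \<noteq> Sep)"] tw by simp
  have inj: "inj encode_value"
  proof (rule injI)
    fix a b assume "encode_value a = encode_value b"
    then show "a = b" by (cases a; cases b) (auto split: if_splits)
  qed
  have "e = d" using pe inj by (simp add: encode_pinst_def)
  moreover have "es = ds" using eq pe Cons.IH by simp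
  ultimately show ?case using es' by simp
qed

lemma encode_inject: "encode T es = encode T' es' \<longleftrightarrow> T = T' \<and> es = es'"
proof
  assume eq: "encode T es = encode T' es'"
  then have 1: "dt_dim T = dt_dim T'"
    and 2: "encode_btree (dt_tree T) @ concat (map (\<lambda>e. Sep # encode_pinst e) es) =
            encode_btree (dt_tree T') @ concat (map (\<lambda>e. Sep # encode_pinst e) es')"
    unfolding encode_def by (auto dest: replicate_Tally_append_eq)
  from encode_btree_append_eq[OF 2] encode_pinsts_eq 1 show "T = T' \<and> es = es'"
    by simp
qed simp

end

theory Submission
  imports Defs "HOL-Library.Countable"
begin

text \<open>
  Whether \<open>\<phi>\<close> holds of \<open>e\<^sub>1, \<dots>, e\<^sub>k\<close> depends only on how many coordinates \<open>i\<close> have a given column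
  \<open>(e\<^sub>1[i], \<dots>, e\<^sub>k[i])\<close>, since permuting the coordinates is an automorphism.  Quantifying over one
  more instance amounts to splitting each of these \<open>3\<^sup>k\<close> counts into three, so for fixed \<open>\<phi>\<close> the
  problem is expressible on the input word in first-order logic with counting, where variables
  range over \<open>{0..length w}\<close>; so is the well-formedness of the input, a preorder encoding being
  recognised by comparing numbers of leaves and inner nodes in its factors.

  Such a formula is evaluated by nested loops with finitely many heads on the read-only input.  A
  multi-tape machine gives each head its own copy of the input.  Its states in this phase are the
  residual programs.  There are polynomially many configurations and a halting deterministic run
  repeats none, so termination alone yields the time bound.
\<close>

section \<open>Multi-head programs\<close>

text \<open>A quantifier over partial instances ranges over \<open>3^n\<close> objects, which cannot
  be searched in polynomial time. The histogram of \<open>k\<close> instances consists of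
  \<open>3^k\<close> numbers of size at most \<open>n\<close>; for fixed \<open>\<phi>\<close> this
  is a constant number of variables. The replacement is exact because of realizability: coordinates
  with the same column may receive their new values in any arrangement, so every splitting of the
  counts is the histogram of some new instance. Comparison of cardinalities is the only binder of
  the logic. Quantifiers and addition are derived from it, and so is the counter of trees still to
  be read in a preorder word, whose value after a prefix is a difference of two counts; no recursion
  along the word has to be expressed. Variables stop at \<open>length w\<close>, so that each fits
  into a head. Terms such as sums may overshoot this range, and for this reason the closure lemmas
  for comparisons ask for a bound on one side.\<close>

datatype 'a test = AtZero nat | AtEnd nat | Letter 'a nat | TNot "'a test" | TAnd "'a test" "'a test"

datatype 'a com =
    Skip
  | Inc nat
  | Dec nat
  | Seq "'a com" "'a com"
  | Cond "'a test" "'a com" "'a com"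
  | While "'a test" "'a com"

instance test :: (countable) countable by countable_datatype
instance com :: (countable) countable by countable_datatype

text \<open>
  Heads move on the positions \<open>{0..Suc (length w)}\<close>, so that a head can hold the number of
  positions in \<open>{0..length w}\<close> with a given property.
\<close>

type_synonym 'a view = "bool \<times> bool \<times> 'a option"

text \<open>The position itself stays hidden: a test sees only whether the head is at one of the two
  ends and which letter it is on. Over a finite alphabet there are finitely many views, so a view
  fits into one tape cell.\<close>

definition view :: "'a list \<Rightarrow> nat \<Rightarrow> 'a view" where
  "view w p = (p = 0, p = Suc (length w), if p < length w then Some (w ! p) else None)"

fun tval :: "(nat \<Rightarrow> 'a view) \<Rightarrow> 'a test \<Rightarrow> bool" where
  "tval r (AtZero x) \<longleftrightarrow> fst (r x)"
| "tval r (AtEnd x) \<longleftrightarrow> fst (snd (r x))"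
| "tval r (Letter a x) \<longleftrightarrow> snd (snd (r x)) = Some a"
| "tval r (TNot b) \<longleftrightarrow> \<not> tval r b"
| "tval r (TAnd b b') \<longleftrightarrow> tval r b \<and> tval r b'"

abbreviation test_holds :: "'a list \<Rightarrow> (nat \<Rightarrow> nat) \<Rightarrow> 'a test \<Rightarrow> bool" where
  "test_holds w s b \<equiv> tval (\<lambda>x. view w (s x)) b"

text \<open>There is no rule for moving a head out of its range, so exhibiting an execution proves
  termination and absence of overflow at once.\<close>

inductive exec :: "'a list \<Rightarrow> 'a com \<Rightarrow> (nat \<Rightarrow> nat) \<Rightarrow> (nat \<Rightarrow> nat) \<Rightarrow> bool" for w where
  Skip: "exec w Skip s s"
| Inc: "s x \<le> length w \<Longrightarrow> exec w (Inc x) s (s(x := Suc (s x)))"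
| Dec: "s x = Suc v \<Longrightarrow> exec w (Dec x) s (s(x := v))"
| Seq: "exec w c s s' \<Longrightarrow> exec w d s' s'' \<Longrightarrow> exec w (Seq c d) s s''"
| CondT: "test_holds w s b \<Longrightarrow> exec w c s s' \<Longrightarrow> exec w (Cond b c d) s s'"
| CondF: "\<not> test_holds w s b \<Longrightarrow> exec w d s s' \<Longrightarrow> exec w (Cond b c d) s s'"
| WhileT: "test_holds w s b \<Longrightarrow> exec w c s s' \<Longrightarrow> exec w (While b c) s' s'' \<Longrightarrow>
    exec w (While b c) s s''"
| WhileF: "\<not> test_holds w s b \<Longrightarrow> exec w (While b c) s s"

text \<open>A small step computed from the views alone, so that it can serve as a transition
  function with the residual program as next state.\<close>

fun nxt :: "(nat \<Rightarrow> 'a view) \<Rightarrow> 'a com \<Rightarrow> 'a com \<times> (nat \<Rightarrow> move)" where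
  "nxt r Skip = (Skip, \<lambda>_. Stay)"
| "nxt r (Inc x) = (Skip, (\<lambda>_. Stay)(x := MoveRight))"
| "nxt r (Dec x) = (Skip, (\<lambda>_. Stay)(x := MoveLeft))"
| "nxt r (Seq c d) =
     (if c = Skip then (d, \<lambda>_. Stay) else (Seq (fst (nxt r c)) d, snd (nxt r c)))"
| "nxt r (Cond b c d) = (if tval r b then c else d, \<lambda>_. Stay)"
| "nxt r (While b c) = (if tval r b then Seq c (While b c) else Skip, \<lambda>_. Stay)"

text \<open>The equation is stated over \<open>int\<close> so that a left move from position 0 has
  no successor, instead of being truncated to 0.\<close>

definition step :: "'a list \<Rightarrow> 'a com \<times> (nat \<Rightarrow> nat) \<Rightarrow> 'a com \<times> (nat \<Rightarrow> nat) \<Rightarrow> bool" where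
  "step w cs cs' \<longleftrightarrow> fst cs \<noteq> Skip \<and>
     fst cs' = fst (nxt (\<lambda>x. view w (snd cs x)) (fst cs)) \<and>
     (\<forall>x. int (snd cs' x) =
            int (snd cs x) + head_shift (snd (nxt (\<lambda>x. view w (snd cs x)) (fst cs)) x) \<and>
          snd cs' x \<le> Suc (length w))"

lemma steps_Seq:
  "(step w)\<^sup>*\<^sup>* cs cs' \<Longrightarrow> (step w)\<^sup>*\<^sup>* (Seq (fst cs) d, snd cs) (Seq (fst cs') d, snd cs')"
proof (induction rule: rtranclp_induct)
  case (step y z)
  have "step w (Seq (fst y) d, snd y) (Seq (fst z) d, snd z)"
    using step.hyps(2) by (auto simp: step_def)
  with step.IH show ?case by (rule rtranclp.rtrancl_into_rtrancl)
qed simp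

text \<open>The bound travels through the induction because \<open>step\<close> demands it of every
  head, including those that stand still.\<close>

lemma exec_steps:
  "exec w c s s' \<Longrightarrow> (\<And>x. s x \<le> Suc (length w)) \<Longrightarrow>
   (step w)\<^sup>*\<^sup>* (c, s) (Skip, s') \<and> (\<forall>x. s' x \<le> Suc (length w))"
proof (induction rule: exec.induct)
  case (Inc s x)
  then have "step w (Inc x, s) (Skip, s(x := Suc (s x)))" by (simp add: step_def)
  moreover have "\<forall>y. (s(x := Suc (s x))) y \<le> Suc (length w)" using Inc by simp
  ultimately show ?case by blast
next
  case (Dec s x v)
  then have "v \<le> Suc (length w)" by (metis Suc_leD)
  with Dec have "step w (Dec x, s) (Skip, s(x := v))" "\<forall>y. (s(x := v)) y \<le> Suc (length w)"
    by (simp_all add: step_def)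
  then show ?case by blast
next
  case (Seq c s s' d s'')
  have "(step w)\<^sup>*\<^sup>* (Seq c d, s) (Seq Skip d, s')"
    using steps_Seq[of w "(c, s)" "(Skip, s')" d] Seq by auto
  moreover have "step w (Seq Skip d, s') (d, s')" using Seq by (simp add: step_def)
  ultimately have "(step w)\<^sup>*\<^sup>* (Seq c d, s) (d, s')" by (rule rtranclp.rtrancl_into_rtrancl)
  then show ?case using Seq by (meson rtranclp_trans)
next
  case (CondT s b c s' d)
  then have "step w (Cond b c d, s) (c, s)" by (simp add: step_def)
  then show ?case using CondT by (meson converse_rtranclp_into_rtranclp)
next
  case (CondF s b d s' c)
  then have "step w (Cond b c d, s) (d, s)" by (simp add: step_def)
  then show ?case using CondF by (meson converse_rtranclp_into_rtranclp)
next
  case (WhileT s b c s' s'')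
  have "step w (While b c, s) (Seq c (While b c), s)" using WhileT by (simp add: step_def)
  moreover have "(step w)\<^sup>*\<^sup>* (Seq c (While b c), s) (Seq Skip (While b c), s')"
    using steps_Seq[of w "(c, s)" "(Skip, s')"] WhileT by auto
  moreover have "step w (Seq Skip (While b c), s') (While b c, s')"
    using WhileT by (simp add: step_def)
  ultimately have "(step w)\<^sup>*\<^sup>* (While b c, s) (While b c, s')"
    by (meson converse_rtranclp_into_rtranclp rtranclp.rtrancl_into_rtrancl)
  then show ?case using WhileT by (meson rtranclp_trans)
next
  case (WhileF s b c)
  then have "step w (While b c, s) (Skip, s)" by (simp add: step_def)
  then show ?case using WhileF by auto
qed auto

text \<open>Finite despite loops: an unfolded loop has the form \<open>Seq c' (While b c)\<close>
  and returns to \<open>While b c\<close> itself, so iterating it creates no further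
  programs.\<close>

fun residuals :: "'a com \<Rightarrow> 'a com set" where
  "residuals Skip = {Skip}"
| "residuals (Inc x) = {Inc x, Skip}"
| "residuals (Dec x) = {Dec x, Skip}"
| "residuals (Seq c d) = (\<lambda>c'. Seq c' d) ` residuals c \<union> residuals d"
| "residuals (Cond b c d) = insert (Cond b c d) (residuals c \<union> residuals d)"
| "residuals (While b c) =
     insert (While b c) (insert Skip ((\<lambda>c'. Seq c' (While b c)) ` residuals c))"

lemma finite_residuals: "finite (residuals c)"
  by (induction c) auto

lemma self_in_residuals: "c \<in> residuals c"
  by (induction c) auto

lemma nxt_in_residuals: "d \<in> residuals c \<Longrightarrow> fst (nxt r d) \<in> residuals c"
  by (induction c arbitrary: d) (auto simp: self_in_residuals split: if_splits)

fun tbelow :: "nat \<Rightarrow> 'a test \<Rightarrow> bool" where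
  "tbelow k (AtZero x) \<longleftrightarrow> x < k"
| "tbelow k (AtEnd x) \<longleftrightarrow> x < k"
| "tbelow k (Letter a x) \<longleftrightarrow> x < k"
| "tbelow k (TNot b) \<longleftrightarrow> tbelow k b"
| "tbelow k (TAnd b b') \<longleftrightarrow> tbelow k b \<and> tbelow k b'"

fun below :: "nat \<Rightarrow> 'a com \<Rightarrow> bool" where
  "below k Skip \<longleftrightarrow> True"
| "below k (Inc x) \<longleftrightarrow> x < k"
| "below k (Dec x) \<longleftrightarrow> x < k"
| "below k (Seq c d) \<longleftrightarrow> below k c \<and> below k d"
| "below k (Cond b c d) \<longleftrightarrow> tbelow k b \<and> below k c \<and> below k d"
| "below k (While b c) \<longleftrightarrow> tbelow k b \<and> below k c"

lemma tbelow_mono: "tbelow k b \<Longrightarrow> k \<le> l \<Longrightarrow> tbelow l b"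
  by (induction b) auto

lemma below_mono: "below k c \<Longrightarrow> k \<le> l \<Longrightarrow> below l c"
  by (induction c) (auto intro: tbelow_mono)

lemma ex_tbelow: "\<exists>k. tbelow k b"
proof (induction b)
  case (TAnd b1 b2)
  then obtain k l where "tbelow k b1" "tbelow l b2" by blast
  then have "tbelow (max k l) (TAnd b1 b2)" by (auto intro: tbelow_mono)
  then show ?case ..
qed auto

lemma ex_below: "\<exists>k. below k c"
proof (induction c)
  case (Seq c d)
  then obtain k l where "below k c" "below l d" by blast
  then have "below (max k l) (Seq c d)" by (auto intro: below_mono)
  then show ?case ..
next
  case (Cond b c d)
  then obtain k l m where "below k c" "below l d" "tbelow m b" using ex_tbelow by blast
  then have "below (max m (max k l)) (Cond b c d)" by (auto intro: below_mono tbelow_mono)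
  then show ?case ..
next
  case (While b c)
  then obtain k m where "below k c" "tbelow m b" using ex_tbelow by blast
  then have "below (max m k) (While b c)" by (auto intro: below_mono tbelow_mono)
  then show ?case ..
qed auto

lemma below_residuals: "d \<in> residuals c \<Longrightarrow> below k c \<Longrightarrow> below k d"
  by (induction c arbitrary: d) auto

lemma tval_cong: "tbelow k b \<Longrightarrow> (\<And>x. x < k \<Longrightarrow> r x = r' x) \<Longrightarrow> tval r b = tval r' b"
  by (induction b) auto

lemma nxt_cong: "below k c \<Longrightarrow> (\<And>x. x < k \<Longrightarrow> r x = r' x) \<Longrightarrow> nxt r c = nxt r' c"
  by (induction c) (auto dest: tval_cong)

section \<open>Simulation by Turing machines\<close>

definition mark :: "'a::finite view \<Rightarrow> 'a cell" where
  "mark v = Work (to_nat v)"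

fun unmark :: "'a::finite cell \<Rightarrow> 'a view" where
  "unmark (Work k) = from_nat k"
| "unmark _ = (False, False, None)"

lemma unmark_mark [simp]: "unmark (mark v) = v"
  by (simp add: mark_def)

definition prog_state :: "'a::finite com \<Rightarrow> nat" where
  "prog_state c = 6 + to_nat c"

text \<open>
  States 0 and 1 accept and reject.  States 2 to 5 replace every tape by the word of views of the
  input (2: first cell, 3: further cells, 4: right end, 5: rewinding); the remaining states are
  the residuals of the program, and \<open>f\<close> is the head whose final position is the answer.
\<close>

definition sim_delta ::
  "nat \<Rightarrow> 'a::finite com \<Rightarrow> nat \<Rightarrow> nat \<Rightarrow> 'a cell list \<Rightarrow> nat \<times> ('a cell \<times> move) list" where
  "sim_delta k c f q ss =
    (if q = 2 \<or> q = 3 then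
       (case hd ss of
          Input a \<Rightarrow> (3, replicate k (mark (q = 2, False, Some a), MoveRight))
        | _ \<Rightarrow> (4, replicate k (mark (q = 2, False, None), MoveRight)))
     else if q = 4 then (5, replicate k (mark (False, True, None), Stay))
     else if q = 5 then
       (if fst (unmark (hd ss)) then (prog_state c, map (\<lambda>s. (s, Stay)) ss)
        else (5, map (\<lambda>s. (s, MoveLeft)) ss))
     else
       (let d = from_nat (q - 6); r = (\<lambda>x. unmark (ss ! x)) in
        if d = Skip then (if fst (r f) then 1 else 0, map (\<lambda>s. (s, Stay)) ss)
        else (prog_state (fst (nxt r d)), map (\<lambda>x. (ss ! x, snd (nxt r d) x)) [0..<k])))"

definition sim :: "nat \<Rightarrow> 'a::finite com \<Rightarrow> nat \<Rightarrow> 'a tm" where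
  "sim k c f =
     \<lparr>tm_tapes = k, tm_states = {..5} \<union> prog_state ` residuals c,
      tm_alphabet = insert Blank (range Input \<union> range mark),
      tm_start = 2, tm_accept = 0, tm_reject = 1, tm_delta = sim_delta k c f\<rparr>"

lemma sim_simps [simp]:
  "tm_tapes (sim k c f) = k" "tm_start (sim k c f) = 2"
  "tm_accept (sim k c f) = 0" "tm_reject (sim k c f) = 1"
  "tm_delta (sim k c f) = sim_delta k c f"
  by (simp_all add: sim_def)

lemma prog_state_neq [simp]: "prog_state c \<noteq> 0" "prog_state c \<noteq> Suc 0" "prog_state c \<noteq> 1" "prog_state c \<noteq> 2"
  "prog_state c \<noteq> 3" "prog_state c \<noteq> 4" "prog_state c \<noteq> 5"
  by (auto simp: prog_state_def)

lemma from_nat_prog_state [simp]: "from_nat (prog_state c - 6) = c"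
  by (simp add: prog_state_def)

lemma turing_machine_sim:
  assumes "1 \<le> k"
  shows "turing_machine (sim k c f)"
proof -
  let ?M = "sim k c f"
  have "fst (sim_delta k c f q ss) \<in> tm_states ?M \<and> length (snd (sim_delta k c f q ss)) = k \<and>
        fst ` set (snd (sim_delta k c f q ss)) \<subseteq> tm_alphabet ?M"
    if q: "q \<in> tm_states ?M - {0, 1}" and l: "length ss = k" and ss: "set ss \<subseteq> tm_alphabet ?M" for q ss
  proof -
    consider "q = 2 \<or> q = 3" | "q = 4" | "q = 5" | d where "d \<in> residuals c" "q = prog_state d"
      using q by (fastforce simp: sim_def)
    then show ?thesis
    proof cases
      case 1
      then show ?thesis using assms
        by (cases "hd ss") (auto simp: sim_delta_def sim_def)
    next
      case 2
      then show ?thesis using assms by (auto simp: sim_delta_def sim_def)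
    next
      case 3
      then show ?thesis using l ss self_in_residuals[of c] 
        by (auto simp: sim_delta_def sim_def)
    next
      case 4
      have "ss ! x \<in> tm_alphabet (sim k c f)" if "x < k" for x using ss l that by auto
      then show ?thesis using 4 l ss nxt_in_residuals[OF 4(1)]
        by (auto simp: sim_delta_def Let_def) (auto simp: sim_def)
    qed
  qed
  moreover have "finite (range (mark :: 'a view \<Rightarrow> 'a cell))" by simp
  ultimately show ?thesis
    using assms finite_residuals[of c] unfolding turing_machine_def
    by (auto simp: sim_def)
qed

definition view_tape :: "'a::finite list \<Rightarrow> int \<Rightarrow> 'a cell" where
  "view_tape w i = (if 0 \<le> i \<and> i \<le> int (Suc (length w)) then mark (view w (nat i)) else Blank)"

text \<open>Only the heads below \<open>k\<close> become tapes; states that agree on these positions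
  are identified.\<close>

definition conf :: "nat \<Rightarrow> 'a::finite list \<Rightarrow> 'a com \<times> (nat \<Rightarrow> nat) \<Rightarrow> 'a config" where
  "conf k w cs = (prog_state (fst cs), map (\<lambda>x. (view_tape w, int (snd cs x))) [0..<k])"

lemma view_tape_nat [simp]: "p \<le> Suc (length w) \<Longrightarrow> view_tape w (int p) = mark (view w p)"
  by (simp add: view_tape_def)

text \<open>All tapes carry the same word of views and every cell is written back unchanged, so one
  program step costs exactly one machine step.\<close>

lemma step_sim:
  assumes "step w cs cs'" "below k (fst cs)" "\<And>x. snd cs x \<le> Suc (length w)"
  shows "tm_step (sim k c f) (conf k w cs) = conf k w cs'"
proof -
  obtain d s where cs: "cs = (d, s)" by (cases cs)
  let ?ss = "map tape_read (map (\<lambda>x. (view_tape w, int (s x))) [0..<k])"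
  have ss: "?ss ! x = mark (view w (s x))" if "x < k" for x
    using that assms(3) by (simp add: cs tape_read_def)
  have n: "nxt (\<lambda>x. unmark (?ss ! x)) d = nxt (\<lambda>x. view w (s x)) d"
    using assms(2) ss by (intro nxt_cong[of k]) (auto simp: cs)
  have "d \<noteq> Skip" using assms(1) by (simp add: step_def cs)
  have t: "tm_step (sim k c f) (conf k w cs) = (prog_state (fst (nxt (\<lambda>x. view w (s x)) d)),
     map2 tape_act (map (\<lambda>x. (?ss ! x, snd (nxt (\<lambda>x. view w (s x)) d) x)) [0..<k])
       (map (\<lambda>x. (view_tape w, int (s x))) [0..<k]))"
    unfolding tm_step_def conf_def cs sim_delta_def sim_simps
    using n \<open>d \<noteq> Skip\<close> by (simp add: Let_def)
  have "map2 tape_act (map (\<lambda>x. (?ss ! x, snd (nxt (\<lambda>x. view w (s x)) d) x)) [0..<k])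
       (map (\<lambda>x. (view_tape w, int (s x))) [0..<k]) =
     map (\<lambda>x. (view_tape w, int (snd cs' x))) [0..<k]"
    using assms(1) by (intro nth_equalityI) (auto simp: step_def cs tape_read_def)
  then show ?thesis using t assms(1) by (simp add: conf_def step_def cs)
qed

section \<open>Counting the configurations of a simulated run\<close>

definition legal :: "nat \<Rightarrow> 'a list \<Rightarrow> 'a com \<Rightarrow> ('a com \<times> (nat \<Rightarrow> nat)) set" where
  "legal k w c = {(d, s). d \<in> residuals c \<and> below k d \<and> (\<forall>x. s x \<le> Suc (length w))}"

lemma step_legal:
  assumes "cs \<in> legal k w c" "step w cs cs'" "below k c"
  shows "cs' \<in> legal k w c"
  using assms nxt_in_residuals[of "fst cs" c] below_residuals
  by (cases cs'; cases cs) (auto simp: legal_def step_def)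

lemma steps_sim:
  assumes "(step w ^^ t) cs cs'" "cs \<in> legal k w c" "below k c"
  shows "(tm_step (sim k c f) ^^ t) (conf k w cs) = conf k w cs' \<and> cs' \<in> legal k w c"
  using assms(1)
proof (induction t arbitrary: cs')
  case 0
  then show ?case using assms by simp
next
  case (Suc t)
  then obtain y where y: "(step w ^^ t) cs y" "step w y cs'" by auto
  then have "cs' \<in> legal k w c" "y \<in> legal k w c" using Suc.IH step_legal assms(3) by blast+
  moreover have "tm_step (sim k c f) (conf k w y) = conf k w cs'"
    using y(2) \<open>y \<in> _\<close> by (intro step_sim) (auto simp: legal_def)
  ultimately show ?case using Suc.IH[OF y(1)] by simp
qed

text \<open>There are infinitely many heads and hence infinitely many legal states, but
  \<open>conf\<close> sees only a residual program and \<open>k\<close> positions, each with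
  \<open>length w + 2\<close> possible values.\<close>

lemma finite_card_conf_legal:
  "finite (conf k w ` legal k w c) \<and>
   card (conf k w ` legal k w c) \<le> card (residuals c) * (length w + 2) ^ k"
proof -
  let ?L = "{xs. set xs \<subseteq> {..Suc (length w)} \<and> length xs = k}"
  let ?g = "\<lambda>(d, xs). (prog_state d, map (\<lambda>v. (view_tape w, int v)) xs)"
  have sub: "conf k w ` legal k w c \<subseteq> ?g ` (residuals c \<times> ?L)"
  proof
    fix z assume "z \<in> conf k w ` legal k w c"
    then obtain d s where ds: "(d, s) \<in> legal k w c" "z = conf k w (d, s)" by auto
    then have "z = ?g (d, map s [0..<k])" "(d, map s [0..<k]) \<in> residuals c \<times> ?L"
      by (auto simp: conf_def legal_def)
    then show "z \<in> ?g ` (residuals c \<times> ?L)" by blast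
  qed
  have fin: "finite (residuals c \<times> ?L)"
    by (intro finite_cartesian_product finite_residuals finite_lists_length_eq) simp
  have "card (residuals c \<times> ?L) = card (residuals c) * (length w + 2) ^ k"
    by (subst card_cartesian_product) (simp add: card_lists_length_eq)
  then show ?thesis
    using finite_subset[OF sub] card_mono[OF _ sub] card_image_le[OF fin, of ?g] fin by simp
qed

text \<open>On a shortest run to \<open>y\<close> no configuration repeats.\<close>

lemma funpow_reach_bound:
  fixes f :: "'b \<Rightarrow> 'b"
  assumes "(f ^^ t) x = y" "\<And>i. i \<le> t \<Longrightarrow> (f ^^ i) x \<in> S" "finite S"
  shows "\<exists>i < card S. (f ^^ i) x = y"
proof -
  define l where "l = (LEAST i. (f ^^ i) x = y)"
  have l: "(f ^^ l) x = y" "l \<le> t" "\<And>i. (f ^^ i) x = y \<Longrightarrow> l \<le> i"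
    unfolding l_def using assms(1) by (auto intro: LeastI Least_le)
  have "False" if "i < j" "j \<le> l" "(f ^^ i) x = (f ^^ j) x" for i j
  proof -
    \<comment> \<open>Cutting out the loop between \<open>i\<close> and \<open>j\<close> reaches
      \<open>y\<close> after \<open>l - j + i\<close> steps, which is less than the minimum
      \<open>l\<close>.\<close>
    have "(f ^^ (l - j + i)) x = (f ^^ (l - j)) ((f ^^ j) x)"
      by (simp only: funpow_add comp_apply that(3))
    also have "\<dots> = (f ^^ (l - j + j)) x" by (simp only: funpow_add comp_apply)
    also have "\<dots> = y" using that l(1) by simp
    finally have "l \<le> l - j + i" by (rule l(3))
    then show False using that by simp
  qed
  then have "inj_on (\<lambda>i. (f ^^ i) x) {..l}"
    by (metis (mono_tags, lifting) atMost_iff inj_onI linorder_neqE_nat)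
  then have "card {..l} \<le> card S"
    using assms(2,3) l(2) by (intro card_inj_on_le) auto
  then have "l < card S" by simp
  then show ?thesis using l(1) by blast
qed

text \<open>The configuration after \<open>i\<close> copying steps. All heads advance together: the
  cells behind them already hold views, and tape 0 alone still carries the unread input.\<close>

definition init_conf :: "nat \<Rightarrow> 'a::finite list \<Rightarrow> nat \<Rightarrow> 'a config" where
  "init_conf k w i =
     (if i = 0 then 2 else if i \<le> length w then 3 else 4,
      map (\<lambda>x. (\<lambda>p. if 0 \<le> p \<and> p < int i then view_tape w p
                   else if x = 0 then fst (input_tape w) p else Blank, int i)) [0..<k])"

lemma tm_initial_sim:
  assumes "1 \<le> k"
  shows "tm_initial (sim k c f) w = init_conf k w 0"
proof -
  have "input_tape w # replicate (k - 1) blank_tape = map (\<lambda>x. (\<lambda>p. if x = 0 then fst (input_tape w) p else Blank, 0)) [0..<k]"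
    using assms by (intro nth_equalityI) (auto simp: nth_Cons' input_tape_def blank_tape_def)
  then show ?thesis
    by (auto simp: tm_initial_def init_conf_def fun_eq_iff)
qed

lemma init_conf_step:
  assumes "1 \<le> k" "i \<le> length w"
  shows "tm_step (sim k c f) (init_conf k w i) = init_conf k w (Suc i)"
proof -
  have hd: "hd (map tape_read (snd (init_conf k w i))) = (if i < length w then Input (w ! i) else Blank)"
    using assms by (simp add: init_conf_def hd_map tape_read_def input_tape_def)
  have v: "mark (i = 0, False, if i < length w then Some (w ! i) else None) = view_tape w (int i)"
    using assms by (simp add: view_def)
  have st: "fst (init_conf k w i) = (if i = 0 then 2 else 3)"
    using assms by (simp add: init_conf_def)
  have delta: "sim_delta k c f (fst (init_conf k w i)) (map tape_read (snd (init_conf k w i))) =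
     (if i < length w then 3 else 4, replicate k (view_tape w (int i), MoveRight))"
    using hd v st by (auto simp: sim_delta_def)
  have "tm_step (sim k c f) (init_conf k w i) = (if i < length w then 3 else 4,
      map2 tape_act (replicate k (view_tape w (int i), MoveRight)) (snd (init_conf k w i)))"
  proof -
    obtain q tps where q: "init_conf k w i = (q, tps)" by fastforce
    have "q \<noteq> 0 \<and> q \<noteq> 1" using st q by (auto split: if_splits)
    then show ?thesis using delta q by (simp add: tm_step_def)
  qed
  also have "map2 tape_act (replicate k (view_tape w (int i), MoveRight)) (snd (init_conf k w i)) =
      snd (init_conf k w (Suc i))"
    by (intro nth_equalityI) (auto simp: init_conf_def fun_eq_iff)
  finally show ?thesis using assms by (auto simp: init_conf_def)
qed

definition rewind_conf :: "nat \<Rightarrow> 'a::finite list \<Rightarrow> nat \<Rightarrow> 'a config" where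
  "rewind_conf k w i = (5, map (\<lambda>x. (view_tape w, int i)) [0..<k])"

lemma init_conf_end:
  "tm_step (sim k c f) (init_conf k w (Suc (length w))) = rewind_conf k w (Suc (length w))"
proof -
  have "map2 tape_act (replicate k (mark (False, True, None), Stay))
          (snd (init_conf k w (Suc (length w)))) = snd (rewind_conf k w (Suc (length w)))"
    by (intro nth_equalityI)
      (auto simp: init_conf_def rewind_conf_def fun_eq_iff view_tape_def input_tape_def view_def nat_add_distrib)
  then show ?thesis
    by (auto simp: tm_step_def rewind_conf_def init_conf_def sim_delta_def)
qed

lemma rewind_conf_step:
  assumes "1 \<le> k" "i \<le> Suc (length w)"
  shows "tm_step (sim k c f) (rewind_conf k w i) =
     (if i = 0 then conf k w (c, \<lambda>_. 0) else rewind_conf k w (i - 1))"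
proof -
  have "fst (unmark (hd (map tape_read (snd (rewind_conf k w i))))) = (i = 0)"
    using assms by (simp add: rewind_conf_def hd_map tape_read_def view_def)
  moreover have "map2 tape_act (map (\<lambda>s. (s, m)) (map tape_read (snd (rewind_conf k w i)))) (snd (rewind_conf k w i)) =
      map (\<lambda>x. (view_tape w, int i + head_shift m)) [0..<k]" for m
    by (intro nth_equalityI) (auto simp: rewind_conf_def tape_read_def)
  ultimately show ?thesis
    by (auto simp: tm_step_def rewind_conf_def sim_delta_def conf_def of_nat_diff)
qed

text \<open>The count consists of \<open>length w + 1\<close> copying steps, one step for the right
  end, \<open>length w + 1\<close> moves back, and one step for entering the program.\<close>

lemma init_sim:
  assumes "1 \<le> k"
  shows "(tm_step (sim k c f) ^^ (2 * length w + 4)) (tm_initial (sim k c f) w) = conf k w (c, \<lambda>_. 0)"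
proof -
  let ?t = "tm_step (sim k c f)"
  have 1: "(?t ^^ i) (tm_initial (sim k c f) w) = init_conf k w i" if "i \<le> Suc (length w)" for i
    using that
  proof (induction i)
    case (Suc i)
    then show ?case using init_conf_step[OF assms, of i] by simp
  qed (simp add: tm_initial_sim[OF assms])
  have 2: "(?t ^^ Suc i) (rewind_conf k w i) = conf k w (c, \<lambda>_. 0)" if "i \<le> Suc (length w)" for i
    using that
  proof (induction i)
    case 0
    then show ?case using rewind_conf_step[OF assms, of 0] by simp
  next
    case (Suc i)
    have "(?t ^^ Suc (Suc i)) (rewind_conf k w (Suc i)) = (?t ^^ Suc i) (?t (rewind_conf k w (Suc i)))"
      by (subst funpow_Suc_right) simp
    then show ?case using rewind_conf_step[OF assms Suc.prems] Suc by simp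
  qed
  have "(?t ^^ Suc (Suc (length w))) (tm_initial (sim k c f) w) = rewind_conf k w (Suc (length w))"
    using 1[of "Suc (length w)"] init_conf_end[of k c f w] by simp
  with 2[of "Suc (length w)"]
  have "(?t ^^ (Suc (Suc (length w)) + Suc (Suc (length w)))) (tm_initial (sim k c f) w) = conf k w (c, \<lambda>_. 0)"
    by (simp only: funpow_add comp_apply)
  moreover have "Suc (Suc (length w)) + Suc (Suc (length w)) = 2 * length w + 4" by simp
  ultimately show ?thesis by (simp only:)
qed

lemma sim_halt:
  assumes "f < k" "s f \<le> Suc (length w)"
  shows "fst (tm_step (sim k c f) (conf k w (Skip, s))) = (if s f = 0 then 1 else 0)"
proof -
  have "unmark (map tape_read (snd (conf k w (Skip, s))) ! f) = view w (s f)"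
    using assms by (simp add: conf_def tape_read_def)
  then show ?thesis
    by (auto simp: tm_step_def conf_def sim_delta_def Let_def view_def)
qed

theorem program_PTIME:
  fixes A :: "'a::finite list set"
  assumes "\<And>w. \<exists>s. exec w c (\<lambda>_. 0) s \<and> (s f \<noteq> 0 \<longleftrightarrow> w \<in> A)"
  shows "A \<in> PTIME"
proof -
  obtain k0 where "below k0 c" using ex_below by blast
  define k where "k = max k0 (Suc f)"
  have k: "below k c" "f < k" "1 \<le> k"
    using \<open>below k0 c\<close> by (auto simp: k_def intro: below_mono)
  let ?M = "sim k c f"
  \<comment> \<open>The linear part pays \<open>2 * length w + 4\<close> steps of preparation and
    one step for the verdict; the other summand bounds the number of configurations of the program
    phase.\<close>
  let ?p = "[:5, 2:] + smult (card (residuals c)) ([:2, 1:] ^ k) :: nat poly"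
  have "\<exists>t \<le> poly ?p (length w). fst ((tm_step ?M ^^ t) (tm_initial ?M w)) =
          (if w \<in> A then tm_accept ?M else tm_reject ?M)" for w
  proof -
    obtain s where s: "exec w c (\<lambda>_. 0) s" "s f \<noteq> 0 \<longleftrightarrow> w \<in> A" using assms by blast
    let ?x = "conf k w (c, \<lambda>_. 0)"
    have st: "(step w)\<^sup>*\<^sup>* (c, \<lambda>_. 0) (Skip, s)" and b: "s f \<le> Suc (length w)"
      using exec_steps[OF s(1)] by auto
    then obtain t where t: "(step w ^^ t) (c, \<lambda>_. 0) (Skip, s)"
      by (auto dest: rtranclp_imp_relpowp)
    have l: "(c, \<lambda>_. 0) \<in> legal k w c" using k(1) by (simp add: legal_def self_in_residuals)
    have "(tm_step ?M ^^ i) ?x \<in> conf k w ` legal k w c" if "i \<le> t" for i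
    proof -
      have "step w ^^ t = (step w ^^ i) OO (step w ^^ (t - i))"
        unfolding relpowp_add[symmetric] using that by simp
      then obtain y where "(step w ^^ i) (c, \<lambda>_. 0) y"
        using t by (auto elim!: relcomppE)
      then show ?thesis using steps_sim[OF _ l k(1)] by blast
    qed
    from funpow_reach_bound[OF conjunct1[OF steps_sim[OF t l k(1)]] this conjunct1[OF finite_card_conf_legal]]
    obtain i where i: "i < card (conf k w ` legal k w c)"
        "(tm_step ?M ^^ i) ?x = conf k w (Skip, s)" by blast
    let ?t = "Suc (i + (2 * length w + 4))"
    have "(tm_step ?M ^^ ?t) (tm_initial ?M w) = tm_step ?M (conf k w (Skip, s))"
      by (simp only: funpow.simps(2) funpow_add[of i "2 * length w + 4"] comp_apply
          init_sim[OF k(3)] i(2))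
    then have "fst ((tm_step ?M ^^ ?t) (tm_initial ?M w)) = (if w \<in> A then tm_accept ?M else tm_reject ?M)"
      using sim_halt[of f k s w c, OF k(2) b] s(2) by (simp only: sim_simps) auto
    moreover have "?t \<le> poly ?p (length w)"
    proof -
      have "i < card (residuals c) * (length w + 2) ^ k"
        using i(1) finite_card_conf_legal[of k w c] by linarith
      then show ?thesis by (simp add: add.commute)
    qed
    ultimately show ?thesis by blast
  qed
  then show ?thesis
    unfolding PTIME_def decides_in_time_def using turing_machine_sim[OF k(3)] by blast
qed

section \<open>First-order logic with counting on words\<close>

text \<open>De Bruijn indices; bound variables range over \<open>{0..length w}\<close>.\<close>

datatype 'a foc =
    IsSym 'a nat
  | LessV nat nat
  | NegC "'a foc"
  | ConjC "'a foc" "'a foc"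
  | CountLe "'a foc" "'a foc"

fun holds :: "'a list \<Rightarrow> (nat \<Rightarrow> nat) \<Rightarrow> 'a foc \<Rightarrow> bool" where
  "holds w s (IsSym a x) \<longleftrightarrow> s x < length w \<and> w ! s x = a"
| "holds w s (LessV x y) \<longleftrightarrow> s x < s y"
| "holds w s (NegC F) \<longleftrightarrow> \<not> holds w s F"
| "holds w s (ConjC F G) \<longleftrightarrow> holds w s F \<and> holds w s G"
| "holds w s (CountLe F G) \<longleftrightarrow>
     card {i. i \<le> length w \<and> holds w (case_nat i s) F} \<le>
     card {i. i \<le> length w \<and> holds w (case_nat i s) G}"

section \<open>Compilation of counting formulas into programs\<close>

definition zero :: "nat \<Rightarrow> 'a com" where
  "zero x = While (TNot (AtZero x)) (Dec x)"

text \<open>Positions cannot be compared directly, so both heads descend in lockstep until one is at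
  0, while head \<open>Suc m\<close> counts. Then \<open>x\<close> was smaller iff \<open>y\<close>
  is not at 0, and the count restores both heads. This needs two different heads, which is why
  \<open>compile\<close> treats equal ones apart.\<close>

definition less_prog :: "nat \<Rightarrow> nat \<Rightarrow> nat \<Rightarrow> 'a com" where
  "less_prog x y m =
     Seq (While (TAnd (TNot (AtZero x)) (TNot (AtZero y)))
            (Seq (Dec x) (Seq (Dec y) (Inc (Suc m)))))
    (Seq (Cond (AtZero y) Skip (Inc m))
         (While (TNot (AtZero (Suc m))) (Seq (Dec (Suc m)) (Seq (Inc x) (Inc y)))))"

text \<open>The exit position is one beyond the largest value of a variable, so the body also runs
  for the value \<open>length w\<close>.\<close>

abbreviation for_prog :: "nat \<Rightarrow> 'a com \<Rightarrow> 'a com" where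
  "for_prog x c \<equiv> While (TNot (AtEnd x)) (Seq c (Inc x))"

text \<open>
  \<open>compile F \<rho> m\<close> leaves the truth value of \<open>F\<close> in head \<open>m\<close> and does not change the heads below
  \<open>m\<close>; the variable \<open>v\<close> of \<open>F\<close> is held by head \<open>\<rho> v\<close>.
\<close>

fun compile :: "'a foc \<Rightarrow> (nat \<Rightarrow> nat) \<Rightarrow> nat \<Rightarrow> 'a com" where
  "compile (IsSym a x) \<rho> m = Seq (zero m) (Cond (Letter a (\<rho> x)) (Inc m) Skip)"
| "compile (LessV x y) \<rho> m =
     Seq (zero m) (if \<rho> x = \<rho> y then Skip else Seq (zero (Suc m)) (less_prog (\<rho> x) (\<rho> y) m))"
| "compile (NegC F) \<rho> m = Seq (compile F \<rho> m) (Cond (AtZero m) (Inc m) (zero m))"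
| "compile (ConjC F G) \<rho> m = Seq (compile F \<rho> m) (Cond (AtZero m) Skip (compile G \<rho> m))"
| "compile (CountLe F G) \<rho> m =
     Seq (zero m)
    (Seq (zero (Suc m))
    (Seq (for_prog (Suc m)
            (Seq (compile F (case_nat (Suc m) \<rho>) (m + 2)) (Cond (AtZero (m + 2)) Skip (Inc m))))
    (Seq (zero (Suc m))
    (Seq (for_prog (Suc m)
            (Seq (compile G (case_nat (Suc m) \<rho>) (m + 2))
                 (Cond (AtZero (m + 2)) Skip (Cond (AtZero m) Skip (Dec m)))))
         (Cond (AtZero m) (Inc m) (zero m))))))"

lemma view_simps [simp]:
  "fst (view w p) \<longleftrightarrow> p = 0"
  "fst (snd (view w p)) \<longleftrightarrow> p = Suc (length w)"
  "snd (snd (view w p)) = Some a \<longleftrightarrow> p < length w \<and> w ! p = a"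
  by (auto simp: view_def)

lemma exec_zero: "exec w (zero x) s (s(x := 0))"
proof (induction "s x" arbitrary: s)
  case 0
  then have "s(x := 0) = s" by auto
  then show ?case using 0 by (auto simp: zero_def intro: exec.WhileF)
next
  case (Suc v)
  have "exec w (Dec x) s (s(x := v))" using Suc.hyps(2) by (auto intro: exec.Dec)
  moreover have "exec w (zero x) (s(x := v)) (s(x := 0))" using Suc.hyps(1)[of "s(x := v)"] by simp
  ultimately show ?case using Suc.hyps(2) unfolding zero_def by (auto intro: exec.WhileT)
qed

lemma exec_bounded:
  assumes "exec w c s s'" "\<And>x. s x \<le> Suc (length w)"
  shows "s' x \<le> Suc (length w)"
  using exec_steps[OF assms] by blast


lemma exec_less_first:
  assumes "x \<noteq> y" "x \<noteq> t" "y \<noteq> t" "min (s x) (s y) + s t \<le> Suc (length w)"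
  shows "exec w (While (TAnd (TNot (AtZero x)) (TNot (AtZero y))) (Seq (Dec x) (Seq (Dec y) (Inc t)))) s
     (s(x := s x - min (s x) (s y), y := s y - min (s x) (s y), t := s t + min (s x) (s y)))"
  using assms(4)
proof (induction "min (s x) (s y)" arbitrary: s)
  case 0
  then have eq: "s(x := s x - min (s x) (s y), y := s y - min (s x) (s y), t := s t + min (s x) (s y)) = s"
    by auto
  have "s x = 0 \<or> s y = 0" using 0 by (auto simp: min_def split: if_splits)
  then show ?case unfolding eq by (intro exec.WhileF) auto
next
  case (Suc n)
  obtain a b where ab: "s x = Suc a" "s y = Suc b" using Suc.hyps(2)
    by (metis min_0L min_0R nat.exhaust nat.simps(3))
  let ?s = "s(x := a, y := b, t := Suc (s t))"
  have body: "exec w (Seq (Dec x) (Seq (Dec y) (Inc t))) s ?s"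
  proof (intro exec.Seq)
    show "exec w (Dec x) s (s(x := a))" using ab by (intro exec.Dec)
    show "exec w (Dec y) (s(x := a)) (s(x := a, y := b))" using ab assms by (intro exec.Dec) simp
    show "exec w (Inc t) (s(x := a, y := b)) ?s"
      using exec.Inc[of "s(x := a, y := b)" t w] Suc assms ab by simp
  qed
  have eq: "?s(x := ?s x - min (?s x) (?s y), y := ?s y - min (?s x) (?s y), t := ?s t + min (?s x) (?s y)) =
    s(x := s x - min (s x) (s y), y := s y - min (s x) (s y), t := s t + min (s x) (s y))"
    using ab assms by (auto simp: fun_eq_iff)
  have n: "n = min (?s x) (?s y)" "min (?s x) (?s y) + ?s t \<le> Suc (length w)"
    using Suc.hyps(2) Suc.prems ab assms by auto
  have "test_holds w s (TAnd (TNot (AtZero x)) (TNot (AtZero y)))" using ab by simp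
  from exec.WhileT[OF this body Suc.hyps(1)[OF n]] show ?case unfolding eq .
qed

lemma exec_less_second:
  assumes "x \<noteq> y" "x \<noteq> t" "y \<noteq> t" "s x + s t \<le> Suc (length w)" "s y + s t \<le> Suc (length w)"
  shows "exec w (While (TNot (AtZero t)) (Seq (Dec t) (Seq (Inc x) (Inc y)))) s
     (s(x := s x + s t, y := s y + s t, t := 0))"
  using assms(4,5)
proof (induction "s t" arbitrary: s)
  case 0
  then have "s(x := s x + s t, y := s y + s t, t := 0) = s"
    by auto
  then show ?case using 0 by (auto intro!: exec.WhileF)
next
  case (Suc n)
  let ?s = "s(t := n, x := Suc (s x), y := Suc (s y))"
  have body: "exec w (Seq (Dec t) (Seq (Inc x) (Inc y))) s ?s"
  proof (intro exec.Seq)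
    show "exec w (Dec t) s (s(t := n))" using Suc by (intro exec.Dec) simp
    show "exec w (Inc x) (s(t := n)) (s(t := n, x := Suc (s x)))"
      using exec.Inc[of "s(t := n)" x w] Suc assms by simp
    show "exec w (Inc y) (s(t := n, x := Suc (s x))) ?s"
      using exec.Inc[of "s(t := n, x := Suc (s x))" y w] Suc assms by simp
  qed
  have eq: "?s(x := ?s x + ?s t, y := ?s y + ?s t, t := 0) =
    s(x := s x + s t, y := s y + s t, t := 0)"
    using assms Suc by (auto simp: fun_eq_iff)
  have n: "n = ?s t" "?s x + ?s t \<le> Suc (length w)" "?s y + ?s t \<le> Suc (length w)"
    using Suc.hyps(2) Suc.prems assms by auto
  have "test_holds w s (TNot (AtZero t))" using Suc.hyps(2) by simp
  from exec.WhileT[OF this body Suc.hyps(1)[OF n]] show ?case unfolding eq .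
qed

lemma exec_less_prog:
  assumes "x \<noteq> y" "x < m" "y < m" "s m = 0" "s (Suc m) = 0"
    and b: "\<And>x. s x \<le> Suc (length w)"
  shows "exec w (less_prog x y m) s (s(m := of_bool (s x < s y)))"
proof -
  let ?d = "min (s x) (s y)"
  let ?s1 = "s(x := s x - ?d, y := s y - ?d, Suc m := ?d)"
  let ?s2 = "?s1(m := of_bool (s x < s y))"
  have "exec w (While (TAnd (TNot (AtZero x)) (TNot (AtZero y))) (Seq (Dec x) (Seq (Dec y) (Inc (Suc m))))) s ?s1"
    using exec_less_first[of x y "Suc m" s w] assms by (simp add: min.coboundedI1)
  moreover have "exec w (Cond (AtZero y) Skip (Inc m)) ?s1 ?s2"
  proof (cases "s x < s y")
    case True
    then show ?thesis using assms exec.Inc[of ?s1 m w] by (intro exec.CondF) auto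
  next
    case False
    then have "?s2 = ?s1" using assms by (auto simp: fun_eq_iff)
    then show ?thesis using False assms exec.Skip[of w ?s1] by (intro exec.CondT) auto
  qed
  moreover have "exec w (While (TNot (AtZero (Suc m))) (Seq (Dec (Suc m)) (Seq (Inc x) (Inc y)))) ?s2
     (s(m := of_bool (s x < s y)))"
  proof -
    have "?s2(x := ?s2 x + ?s2 (Suc m), y := ?s2 y + ?s2 (Suc m), Suc m := 0) = s(m := of_bool (s x < s y))"
      using assms by (auto simp: fun_eq_iff)
    then show ?thesis using exec_less_second[of x y "Suc m" ?s2 w] assms by simp
  qed
  ultimately show ?thesis unfolding less_prog_def by (blast intro: exec.Seq)
qed

text \<open>The index of the invariant is the number of values already treated. The invariant is
  demanded of the state after the increment since it may speak of all heads, including the loop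
  head.\<close>

lemma exec_for:
  assumes body: "\<And>s. I (s x) s \<Longrightarrow> s x \<le> length w \<Longrightarrow>
      \<exists>s'. exec w c s s' \<and> s' x = s x \<and> I (Suc (s x)) (s'(x := Suc (s x)))"
    and "I (s x) s" "s x \<le> Suc (length w)"
  shows "\<exists>s'. exec w (for_prog x c) s s' \<and> I (Suc (length w)) s'"
  using assms(2,3)
proof (induction "Suc (length w) - s x" arbitrary: s)
  case 0
  then have "s x = Suc (length w)" by simp
  then show ?case using 0 exec.WhileF[of w s "TNot (AtEnd x)"] by auto
next
  case (Suc n)
  then have le: "s x \<le> length w" by linarith
  obtain s' where s': "exec w c s s'" "s' x = s x" "I (Suc (s x)) (s'(x := Suc (s x)))"
    using body[OF Suc.prems(1) le] by blast
  have 1: "exec w (Seq c (Inc x)) s (s'(x := Suc (s x)))"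
    using s' le exec.Inc[of s' x w] by (auto intro: exec.Seq)
  obtain s'' where s'': "exec w (for_prog x c) (s'(x := Suc (s x))) s''" "I (Suc (length w)) s''"
    using Suc.hyps(1)[of "s'(x := Suc (s x))"] Suc.hyps(2) s' le by (auto simp: Suc_diff_le)
  have "test_holds w s (TNot (AtEnd x))" using le by simp
  from exec.WhileT[OF this 1 s''(1)] s''(2) show ?case by blast
qed

lemma exec_negate:
  "exec w (Cond (AtZero m) (Inc m) (zero m)) s (s(m := of_bool (s m = 0)))"
  using exec.Inc[of s m w] exec_zero[of w m s]
  by (cases "s m = 0") (auto intro: exec.CondT exec.CondF)

lemma card_Collect_less_Suc:
  "card {j. j < Suc i \<and> P j} = card {j. j < i \<and> P j} + of_bool (P i)"
proof -
  have "{j. j < Suc i \<and> P j} = {j. j < i \<and> P j} \<union> (if P i then {i} else {})"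
    by (auto simp: less_Suc_eq)
  then show ?thesis by (auto simp: card_insert_if)
qed

lemma compile_resultI:
  "exec w c s s' \<Longrightarrow> (\<And>x. x < m \<Longrightarrow> s' x = s x) \<Longrightarrow> s' m = b \<Longrightarrow>
   \<exists>s'. exec w c s s' \<and> (\<forall>x < m. s' x = s x) \<and> s' m = b"
  by blast

text \<open>Heads from \<open>m\<close> on may hold garbage and are cleared before use. For
  \<open>CountLe\<close>, head \<open>m\<close> is the only counter: the first loop adds the
  positions satisfying \<open>F\<close>, the second subtracts those satisfying \<open>G\<close> and
  stops at 0, and the comparison is true iff 0 is left. Head \<open>Suc m\<close> holds the bound
  variable, hence the offset \<open>m + 2\<close> for the subformulas.\<close>

lemma compile_correct:
  assumes "\<And>v. \<rho> v < m" "\<And>x. s x \<le> Suc (length w)"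
  shows "\<exists>s'. exec w (compile F \<rho> m) s s' \<and> (\<forall>x < m. s' x = s x) \<and>
            s' m = of_bool (holds w (\<lambda>v. s (\<rho> v)) F)"
  using assms
proof (induction F arbitrary: \<rho> m s)
  case (IsSym a x)
  let ?s = "s(m := 0)"
  have "exec w (Cond (Letter a (\<rho> x)) (Inc m) Skip) ?s
      (?s(m := of_bool (s (\<rho> x) < length w \<and> w ! s (\<rho> x) = a)))"
    using exec.Inc[of ?s m w] exec.Skip[of w ?s] IsSym(1)[of x]
    by (cases "s (\<rho> x) < length w \<and> w ! s (\<rho> x) = a") (auto intro: exec.CondT exec.CondF)
  then have "exec w (compile (IsSym a x) \<rho> m) s
      (?s(m := of_bool (s (\<rho> x) < length w \<and> w ! s (\<rho> x) = a)))"
    using exec_zero[of w m s] by (auto intro: exec.Seq)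
  then show ?case by (rule compile_resultI) auto
next
  case (LessV x y)
  let ?s = "s(m := 0)" and ?s1 = "s(m := 0, Suc m := 0)"
  show ?case
  proof (cases "\<rho> x = \<rho> y")
    case True
    then have "exec w (compile (LessV x y) \<rho> m) s ?s"
      using exec_zero[of w m s] by (auto intro: exec.Seq exec.Skip)
    then show ?thesis by (rule compile_resultI) (use True in auto)
  next
    case False
    have le: "exec w (less_prog (\<rho> x) (\<rho> y) m) ?s1 (?s1(m := of_bool (?s1 (\<rho> x) < ?s1 (\<rho> y))))"
      using LessV False by (intro exec_less_prog) auto
    have "exec w (compile (LessV x y) \<rho> m) s (?s1(m := of_bool (?s1 (\<rho> x) < ?s1 (\<rho> y))))"
      unfolding compile.simps if_not_P[OF False]
      by (rule exec.Seq[OF exec_zero exec.Seq[OF exec_zero le]])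
    then show ?thesis by (rule compile_resultI) (use LessV(1)[of x] LessV(1)[of y] in auto)
  qed
next
  case (NegC F)
  obtain s' where s': "exec w (compile F \<rho> m) s s'" "\<forall>x < m. s' x = s x"
      "s' m = of_bool (holds w (\<lambda>v. s (\<rho> v)) F)"
    using NegC.IH[of \<rho> m s, OF NegC.prems] by blast
  have "exec w (compile (NegC F) \<rho> m) s (s'(m := of_bool (s' m = 0)))"
    using s' exec_negate[of w m s'] by (auto intro: exec.Seq)
  then show ?case by (rule compile_resultI) (use s' in auto)
next
  case (ConjC F G)
  obtain s' where s': "exec w (compile F \<rho> m) s s'" "\<forall>x < m. s' x = s x"
      "s' m = of_bool (holds w (\<lambda>v. s (\<rho> v)) F)"
    using ConjC.IH(1)[of \<rho> m s, OF ConjC.prems] by blast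
  have eq: "(\<lambda>v. s' (\<rho> v)) = (\<lambda>v. s (\<rho> v))" using s'(2) ConjC.prems(1) by auto
  obtain s'' where s'': "exec w (compile G \<rho> m) s' s''" "\<forall>x < m. s'' x = s' x"
      "s'' m = of_bool (holds w (\<lambda>v. s (\<rho> v)) G)"
    using ConjC.IH(2)[of \<rho> m s'] ConjC.prems exec_bounded[OF s'(1)] eq by auto
  show ?case
  proof (cases "holds w (\<lambda>v. s (\<rho> v)) F")
    case True
    then have "exec w (compile (ConjC F G) \<rho> m) s s''"
      using s' s'' by (auto intro!: exec.Seq[OF s'(1)] exec.CondF)
    then show ?thesis by (rule compile_resultI) (use s' s'' True in auto)
  next
    case False
    then have "exec w (compile (ConjC F G) \<rho> m) s s'"
      using s' by (auto intro!: exec.Seq[OF s'(1)] exec.CondT exec.Skip)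
    then show ?thesis by (rule compile_resultI) (use s' False in auto)
  qed
next
  case (CountLe F G)
  let ?e = "\<lambda>v. s (\<rho> v)"
  let ?\<rho> = "case_nat (Suc m) \<rho>"
  let ?F = "\<lambda>i. holds w (case_nat i ?e) F" and ?G = "\<lambda>i. holds w (case_nat i ?e) G"
  have \<rho>: "?\<rho> v < m + 2" for v using CountLe.prems(1) by (auto split: nat.split intro: less_SucI)
  have env: "(\<lambda>v. s' (?\<rho> v)) = case_nat (s' (Suc m)) ?e" if "\<forall>x < m. s' x = s x" for s'
    using that CountLe.prems(1) by (auto simp: fun_eq_iff split: nat.split)
  let ?s1 = "s(m := 0, Suc m := 0)"
  let ?I = "\<lambda>i s'. (\<forall>x < m. s' x = s x) \<and> (\<forall>x. s' x \<le> Suc (length w)) \<and>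
     s' m = card {j. j < i \<and> ?F j}"
  have cardle: "card {j. j < i \<and> P j} \<le> i" for i and P :: "nat \<Rightarrow> bool"
    using card_mono[of "{..<i}" "{j. j < i \<and> P j}"] by auto
  have "\<exists>s2. exec w (for_prog (Suc m)
          (Seq (compile F ?\<rho> (m + 2)) (Cond (AtZero (m + 2)) Skip (Inc m)))) ?s1 s2 \<and> ?I (Suc (length w)) s2"
  proof (rule exec_for[where I = ?I])
    fix s' :: "nat \<Rightarrow> nat"
    assume I: "?I (s' (Suc m)) s'" and le: "s' (Suc m) \<le> length w"
    obtain t where t: "exec w (compile F ?\<rho> (m + 2)) s' t" "\<forall>x < m + 2. t x = s' x"
        "t (m + 2) = of_bool (?F (s' (Suc m)))"
      using CountLe.IH(1)[of ?\<rho> "m + 2" s'] \<rho> I env[of s'] by auto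
    let ?t = "if ?F (s' (Suc m)) then t(m := Suc (t m)) else t"
    \<comment> \<open>At most as many positions have been counted as were visited before the current
      one, so \<open>Inc\<close> cannot overflow.\<close>
    have "t m \<le> length w" using cardle[of "s' (Suc m)" ?F] t(2) I le by auto
    then have "exec w (Cond (AtZero (m + 2)) Skip (Inc m)) t ?t"
      using t(3) exec.Inc[of t m w] by (auto intro: exec.CondT exec.CondF exec.Skip)
    then have ex: "exec w (Seq (compile F ?\<rho> (m + 2)) (Cond (AtZero (m + 2)) Skip (Inc m))) s' ?t"
      using t(1) by (rule exec.Seq[rotated])
    have upd: "\<forall>x. (g(Suc m := Suc (s' (Suc m)))) x \<le> Suc (length w)"
      if "\<And>x. g x \<le> Suc (length w)" for g using that le by simp
    have bt: "?t x \<le> Suc (length w)" for x using exec_bounded[OF ex] I by blast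
    show "\<exists>s''. exec w (Seq (compile F ?\<rho> (m + 2)) (Cond (AtZero (m + 2)) Skip (Inc m))) s' s'' \<and>
        s'' (Suc m) = s' (Suc m) \<and> ?I (Suc (s' (Suc m))) (s''(Suc m := Suc (s' (Suc m))))"
    proof (intro exI[of _ ?t] conjI, rule ex)
      show "?t (Suc m) = s' (Suc m)" using t(2) by simp
      show "\<forall>x < m. (?t(Suc m := Suc (s' (Suc m)))) x = s x" using t(2) I by simp
      show "\<forall>x. (?t(Suc m := Suc (s' (Suc m)))) x \<le> Suc (length w)"
        by (rule upd[OF bt])
      show "(?t(Suc m := Suc (s' (Suc m)))) m = card {j. j < Suc (s' (Suc m)) \<and> ?F j}"
        using t(2) I by (simp add: card_Collect_less_Suc)
    qed
  qed (use CountLe.prems in \<open>simp_all del: One_nat_def\<close>)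
  then obtain s2 where s2: "exec w (for_prog (Suc m)
          (Seq (compile F ?\<rho> (m + 2)) (Cond (AtZero (m + 2)) Skip (Inc m)))) ?s1 s2" "?I (Suc (length w)) s2"
    by blast
  let ?s3 = "s2(Suc m := 0)"
  \<comment> \<open>The guard on \<open>AtZero m\<close> makes \<open>Dec\<close> stop at 0 exactly
    as subtraction on \<open>nat\<close> does, so truncation is part of the invariant.\<close>
  let ?J = "\<lambda>i s'. (\<forall>x < m. s' x = s x) \<and> (\<forall>x. s' x \<le> Suc (length w)) \<and>
     s' m = s2 m - card {j. j < i \<and> ?G j}"
  let ?D = "Cond (AtZero (m + 2)) Skip (Cond (AtZero m) Skip (Dec m))"
  have "\<exists>s4. exec w (for_prog (Suc m) (Seq (compile G ?\<rho> (m + 2)) ?D)) ?s3 s4 \<and> ?J (Suc (length w)) s4"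
  proof (rule exec_for[where I = ?J])
    fix s' :: "nat \<Rightarrow> nat"
    assume J: "?J (s' (Suc m)) s'" and le: "s' (Suc m) \<le> length w"
    obtain t where t: "exec w (compile G ?\<rho> (m + 2)) s' t" "\<forall>x < m + 2. t x = s' x"
        "t (m + 2) = of_bool (?G (s' (Suc m)))"
      using CountLe.IH(2)[of ?\<rho> "m + 2" s'] \<rho> J env[of s'] by auto
    let ?t = "if ?G (s' (Suc m)) then t(m := t m - 1) else t"
    have "exec w (Cond (AtZero m) Skip (Dec m)) t (t(m := t m - 1))"
    proof (cases "t m")
      case 0
      then have "t(m := t m - 1) = t" by auto
      then show ?thesis using 0 by (auto intro: exec.CondT exec.Skip)
    next
      case (Suc v)
      then show ?thesis using exec.Dec[of t m v w] by (auto intro: exec.CondF)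
    qed
    then have "exec w ?D t ?t"
      using t(3) by (auto intro: exec.CondT exec.CondF exec.Skip)
    then have ex: "exec w (Seq (compile G ?\<rho> (m + 2)) ?D) s' ?t"
      using t(1) by (rule exec.Seq[rotated])
    have upd: "\<forall>x. (g(Suc m := Suc (s' (Suc m)))) x \<le> Suc (length w)"
      if "\<And>x. g x \<le> Suc (length w)" for g using that le by simp
    have bt: "?t x \<le> Suc (length w)" for x using exec_bounded[OF ex] J by blast
    show "\<exists>s''. exec w (Seq (compile G ?\<rho> (m + 2)) ?D) s' s'' \<and>
        s'' (Suc m) = s' (Suc m) \<and> ?J (Suc (s' (Suc m))) (s''(Suc m := Suc (s' (Suc m))))"
    proof (intro exI[of _ ?t] conjI, rule ex)
      show "?t (Suc m) = s' (Suc m)" using t(2) by simp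
      show "\<forall>x < m. (?t(Suc m := Suc (s' (Suc m)))) x = s x" using t(2) J by simp
      show "\<forall>x. (?t(Suc m := Suc (s' (Suc m)))) x \<le> Suc (length w)"
        by (rule upd[OF bt])
      show "(?t(Suc m := Suc (s' (Suc m)))) m = s2 m - card {j. j < Suc (s' (Suc m)) \<and> ?G j}"
        using t(2) J by (simp add: card_Collect_less_Suc)
    qed
  qed (use s2 in auto)
  then obtain s4 where s4: "exec w (for_prog (Suc m) (Seq (compile G ?\<rho> (m + 2)) ?D)) ?s3 s4"
      "?J (Suc (length w)) s4"
    by blast
  let ?s5 = "s4(m := of_bool (s4 m = 0))"
  have "exec w (Cond (AtZero m) (Inc m) (zero m)) s4 ?s5"
    by (rule exec_negate)
  from exec.Seq[OF exec_zero exec.Seq[OF exec_zero exec.Seq[OF s2(1)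
    exec.Seq[OF exec_zero exec.Seq[OF s4(1) this]]]]]
  have "exec w (compile (CountLe F G) \<rho> m) s ?s5"
    unfolding compile.simps .
  then show ?case by (rule compile_resultI) (use s2(2) s4(2) in \<open>auto simp: less_Suc_eq_le\<close>)
qed

text \<open>Every free variable is held by head 0, which starts at 0 and is preserved because it
  lies below the result head 1.\<close>

theorem holds_PTIME: "{w :: 'a::finite list. holds w (\<lambda>_. 0) F} \<in> PTIME"
proof (rule program_PTIME)
  fix w :: "'a list"
  show "\<exists>s. exec w (compile F (\<lambda>_. 0) 1) (\<lambda>_. 0) s \<and> (s 1 \<noteq> 0 \<longleftrightarrow> w \<in> {w. holds w (\<lambda>_. 0) F})"
    using compile_correct[of "\<lambda>_. 0" 1 "\<lambda>_. 0" w F] by auto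
qed

section \<open>Definable predicates and terms\<close>

text \<open>One formula must work for all words, but only for assignments within the range of the
  bound variables.\<close>

definition definable :: "('a list \<Rightarrow> (nat \<Rightarrow> nat) \<Rightarrow> bool) \<Rightarrow> bool" where
  "definable P \<longleftrightarrow> (\<exists>F. \<forall>w s. (\<forall>x. s x \<le> length w) \<longrightarrow> holds w s F = P w s)"

text \<open>
  Only the values of a term up to \<open>length w\<close> are visible to its graph, so a term may exceed the
  range of the variables.
\<close>

definition dterm :: "('a list \<Rightarrow> (nat \<Rightarrow> nat) \<Rightarrow> nat) \<Rightarrow> bool" where
  "dterm t \<longleftrightarrow> definable (\<lambda>w s. t w (\<lambda>v. s (Suc v)) = s 0)"

theorem definable_PTIME:
  assumes "definable (\<lambda>(w :: 'a::finite list) s. P w)"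
  shows "{w. P w} \<in> PTIME"
proof -
  obtain F :: "'a foc" where "\<forall>w s. (\<forall>x. s x \<le> length w) \<longrightarrow> holds w s F = P w"
    using assms by (auto simp: definable_def)
  then have "{w. P w} = {w. holds w (\<lambda>_. 0) F}" by auto
  then show ?thesis by (simp add: holds_PTIME)
qed

lemma definable_cong:
  assumes "definable P" "\<And>w s. (\<And>x. s x \<le> length w) \<Longrightarrow> P w s = Q w s"
  shows "definable Q"
proof -
  obtain F where "\<forall>w s. (\<forall>x. s x \<le> length w) \<longrightarrow> holds w s F = P w s"
    using assms(1) by (auto simp: definable_def)
  then have "\<forall>w s. (\<forall>x. s x \<le> length w) \<longrightarrow> holds w s F = Q w s" using assms(2) by auto
  then show ?thesis unfolding definable_def ..
qed

lemma definable_not: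
  assumes "definable P"
  shows "definable (\<lambda>w s. \<not> P w s)"
proof -
  obtain F where "\<forall>w s. (\<forall>x. s x \<le> length w) \<longrightarrow> holds w s F = P w s"
    using assms by (auto simp: definable_def)
  then have "\<forall>w s. (\<forall>x. s x \<le> length w) \<longrightarrow> holds w s (NegC F) = (\<not> P w s)" by simp
  then show ?thesis unfolding definable_def ..
qed

lemma definable_conj:
  assumes "definable P" "definable Q"
  shows "definable (\<lambda>w s. P w s \<and> Q w s)"
proof -
  obtain F G where "\<forall>w s. (\<forall>x. s x \<le> length w) \<longrightarrow> holds w s F = P w s"
      "\<forall>w s. (\<forall>x. s x \<le> length w) \<longrightarrow> holds w s G = Q w s"
    using assms by (auto simp: definable_def)
  then have "\<forall>w s. (\<forall>x. s x \<le> length w) \<longrightarrow> holds w s (ConjC F G) = (P w s \<and> Q w s)" by simp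
  then show ?thesis unfolding definable_def ..
qed

lemma definable_disj:
  assumes "definable P" "definable Q"
  shows "definable (\<lambda>w s. P w s \<or> Q w s)"
proof -
  have "definable (\<lambda>w s. \<not> (\<not> P w s \<and> \<not> Q w s))"
    by (intro definable_not definable_conj assms)
  then show ?thesis by simp
qed

lemma definable_imp:
  assumes "definable P" "definable Q"
  shows "definable (\<lambda>w s. P w s \<longrightarrow> Q w s)"
proof -
  have "definable (\<lambda>w s. \<not> P w s \<or> Q w s)"
    by (intro definable_not definable_disj assms)
  then show ?thesis by simp
qed

lemma definable_less_var: "definable (\<lambda>w s. s x < s y)"
  unfolding definable_def by (rule exI[of _ "LessV x y"]) simp

lemma definable_const: "definable (\<lambda>w s. b)"
proof (cases b)
  case True
  have "definable (\<lambda>w s. \<not> s 0 < s 0)" by (intro definable_not definable_less_var)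
  then show ?thesis using True by simp
next
  case False
  have "definable (\<lambda>w s. s 0 < s 0)" by (rule definable_less_var)
  then show ?thesis using False by simp
qed

lemma definable_finite_all:
  assumes "finite A" "\<And>a. a \<in> A \<Longrightarrow> definable (P a)"
  shows "definable (\<lambda>w s. \<forall>a \<in> A. P a w s)"
  using assms
proof (induction A)
  case (insert a A)
  have "definable (\<lambda>w s. P a w s \<and> (\<forall>a \<in> A. P a w s))"
    by (intro definable_conj insert.IH insert.prems) auto
  then show ?case by simp
qed (simp add: definable_const)

lemma definable_card_le:
  assumes "definable (\<lambda>w s. P w (\<lambda>v. s (Suc v)) (s 0))" "definable (\<lambda>w s. Q w (\<lambda>v. s (Suc v)) (s 0))"
  shows "definable (\<lambda>w s. card {i. i \<le> length w \<and> P w s i} \<le> card {i. i \<le> length w \<and> Q w s i})"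
proof -
  obtain F G where F: "\<And>w s. (\<forall>x. s x \<le> length w) \<Longrightarrow> holds w s F = P w (\<lambda>v. s (Suc v)) (s 0)"
    and G: "\<And>w s. (\<forall>x. s x \<le> length w) \<Longrightarrow> holds w s G = Q w (\<lambda>v. s (Suc v)) (s 0)"
    using assms by (auto simp: definable_def)
  have "holds w s (CountLe F G) \<longleftrightarrow>
      card {i. i \<le> length w \<and> P w s i} \<le> card {i. i \<le> length w \<and> Q w s i}"
    if "\<forall>x. s x \<le> length w" for w s
  proof -
    have "holds w (case_nat i s) F = P w s i" "holds w (case_nat i s) G = Q w s i"
      if "i \<le> length w" for i
    proof -
      have b: "\<forall>x. case_nat i s x \<le> length w"
        using that \<open>\<forall>x. s x \<le> length w\<close> by (simp split: nat.split)
      show "holds w (case_nat i s) F = P w s i" "holds w (case_nat i s) G = Q w s i"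
        using F[OF b] G[OF b] by simp_all
    qed
    then show ?thesis by (simp cong: conj_cong)
  qed
  then show ?thesis unfolding definable_def by blast
qed

text \<open>A witness exists iff the count is not at most that of the empty set.\<close>

lemma definable_ex:
  assumes "definable (\<lambda>w s. P w (\<lambda>v. s (Suc v)) (s 0))"
  shows "definable (\<lambda>w s. \<exists>i \<le> length w. P w s i)"
proof (rule definable_cong)
  show "definable (\<lambda>w s. \<not> card {i. i \<le> length w \<and> P w s i} \<le> card {i. i \<le> length w \<and> False})"
    by (intro definable_not definable_card_le assms definable_const)
next
  fix w :: "'a list" and s :: "nat \<Rightarrow> nat"
  have "finite {i. i \<le> length w \<and> P w s i}" by simp
  then show "\<not> card {i. i \<le> length w \<and> P w s i} \<le> card {i. i \<le> length w \<and> False} \<longleftrightarrow>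
      (\<exists>i \<le> length w. P w s i)"
    by auto
qed

lemma definable_all:
  assumes "definable (\<lambda>w s. P w (\<lambda>v. s (Suc v)) (s 0))"
  shows "definable (\<lambda>w s. \<forall>i \<le> length w. P w s i)"
proof -
  have "definable (\<lambda>w s. \<not> (\<exists>i \<le> length w. \<not> P w s i))"
    by (intro definable_not definable_ex assms)
  then show ?thesis by simp
qed

section \<open>Renaming and substitution\<close>

fun rename :: "(nat \<Rightarrow> nat) \<Rightarrow> 'a foc \<Rightarrow> 'a foc" where
  "rename f (IsSym a x) = IsSym a (f x)"
| "rename f (LessV x y) = LessV (f x) (f y)"
| "rename f (NegC F) = NegC (rename f F)"
| "rename f (ConjC F G) = ConjC (rename f F) (rename f G)"
| "rename f (CountLe F G) =
     CountLe (rename (case_nat 0 (\<lambda>v. Suc (f v))) F) (rename (case_nat 0 (\<lambda>v. Suc (f v))) G)"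

lemma holds_rename: "holds w s (rename f F) = holds w (\<lambda>v. s (f v)) F"
proof (induction F arbitrary: f s)
  case (CountLe F G)
  have "(\<lambda>v. case_nat i s (case_nat 0 (\<lambda>v. Suc (f v)) v)) = case_nat i (\<lambda>v. s (f v))" for i :: nat
    by (auto simp: fun_eq_iff split: nat.split)
  then show ?case by (simp add: CountLe.IH)
qed auto

lemma definable_rename:
  assumes "definable P"
  shows "definable (\<lambda>w s. P w (\<lambda>v. s (f v)))"
proof -
  obtain F where F: "\<And>w s. (\<forall>x. s x \<le> length w) \<Longrightarrow> holds w s F = P w s"
    using assms by (auto simp: definable_def)
  have "\<forall>w s. (\<forall>x. s x \<le> length w) \<longrightarrow> holds w s (rename f F) = P w (\<lambda>v. s (f v))"
    by (simp add: holds_rename F)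
  then show ?thesis unfolding definable_def by blast
qed

lemma dterm_shift:
  assumes "dterm t"
  shows "dterm (\<lambda>w s. t w (\<lambda>v. s (Suc v)))"
  using definable_rename[of "\<lambda>w s. t w (\<lambda>v. s (Suc v)) = s 0" "case_nat 0 (\<lambda>v. Suc (Suc v))"] assms
  by (simp add: dterm_def)

lemma definable_eq_var: "definable (\<lambda>w s. s x = s y)"
proof -
  have "definable (\<lambda>w s. \<not> s x < s y \<and> \<not> s y < s x)"
    by (intro definable_conj definable_not definable_less_var)
  then show ?thesis by (rule definable_cong) auto
qed

text \<open>Formulas contain no terms, so a term enters through a quantifier over its value. This
  quantifier finds only values up to \<open>length w\<close>, hence the extra conjunct.\<close>

lemma definable_subst:
  assumes "dterm t" "definable (\<lambda>w s. P w (\<lambda>v. s (Suc v)) (s 0))"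
  shows "definable (\<lambda>w s. t w s \<le> length w \<and> P w s (t w s))"
proof (rule definable_cong)
  show "definable (\<lambda>w s. \<exists>i \<le> length w. t w s = i \<and> P w s i)"
    using assms by (intro definable_ex definable_conj) (simp_all add: dterm_def)
qed auto

section \<open>Counting terms and arithmetic\<close>

lemma dterm_var: "dterm (\<lambda>w s. s x)"
  unfolding dterm_def by (rule definable_eq_var)

lemma dterm_length: "dterm (\<lambda>w s. length w)"
proof -
  have "definable (\<lambda>w s. \<forall>i \<le> length w. \<not> s 0 < i)"
    by (intro definable_all definable_not definable_less_var)
  then show ?thesis unfolding dterm_def
  proof (rule definable_cong)
    fix w :: "'a list" and s :: "nat \<Rightarrow> nat"
    assume "\<And>x. s x \<le> length w"
    from this[of 0] show "(\<forall>i \<le> length w. \<not> s 0 < i) \<longleftrightarrow> length w = s 0" by auto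
  qed
qed

text \<open>The candidate value \<open>s 0\<close> is itself turned into a count, that of the
  positions below it, so that two counts are compared.\<close>

lemma dterm_card:
  assumes "definable (\<lambda>w s. P w (\<lambda>v. s (Suc v)) (s 0))"
  shows "dterm (\<lambda>w s. card {i. i \<le> length w \<and> P w s i})"
proof -
  have P: "definable (\<lambda>w s. P w (\<lambda>v. s (Suc (Suc v))) (s 0))"
    using definable_rename[OF assms, of "case_nat 0 (\<lambda>v. Suc (Suc v))"] by simp
  have L: "definable (\<lambda>w s. s 0 < s (Suc 0))" by (rule definable_less_var)
  have "definable (\<lambda>w s. card {i. i \<le> length w \<and> P w (\<lambda>v. s (Suc v)) i} \<le> card {i. i \<le> length w \<and> i < s 0} \<and>
     card {i. i \<le> length w \<and> i < s 0} \<le> card {i. i \<le> length w \<and> P w (\<lambda>v. s (Suc v)) i})"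
    using P L by (intro definable_conj definable_card_le)
  then show ?thesis unfolding dterm_def
  proof (rule definable_cong)
    fix w :: "'a list" and s :: "nat \<Rightarrow> nat"
    assume "\<And>x. s x \<le> length w"
    then have "{i. i \<le> length w \<and> i < s 0} = {..<s 0}" by (auto intro: order.trans less_imp_le)
    then have "card {i. i \<le> length w \<and> i < s 0} = s 0" by simp
    then show "(card {i. i \<le> length w \<and> P w (\<lambda>v. s (Suc v)) i} \<le> card {i. i \<le> length w \<and> i < s 0} \<and>
     card {i. i \<le> length w \<and> i < s 0} \<le> card {i. i \<le> length w \<and> P w (\<lambda>v. s (Suc v)) i}) \<longleftrightarrow>
     card {i. i \<le> length w \<and> P w (\<lambda>v. s (Suc v)) i} = s 0" by auto
  qed
qed

lemma dterm_0: "dterm (\<lambda>w s. 0)"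
  using dterm_card[of "\<lambda>w s i. False"] by (simp add: definable_const)

text \<open>Addition comes from counting: the interval from \<open>s x\<close> up to
  \<open>s z\<close> must have as many elements as the initial segment below
  \<open>s y\<close>.\<close>

lemma definable_add_var: "definable (\<lambda>w s. s x + s y = s z)"
proof -
  have "definable (\<lambda>w s. \<not> s z < s x \<and> (card {i. i \<le> length w \<and> (\<not> i < s x \<and> i < s z)} \<le> card {i. i \<le> length w \<and> i < s y} \<and>
     card {i. i \<le> length w \<and> i < s y} \<le> card {i. i \<le> length w \<and> (\<not> i < s x \<and> i < s z)}))"
    by (intro definable_conj definable_card_le definable_not definable_less_var)
  then show ?thesis
  proof (rule definable_cong)
    fix w :: "'a list" and s :: "nat \<Rightarrow> nat"
    assume b: "\<And>x. s x \<le> length w"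
    then have "{i. i \<le> length w \<and> i < s y} = {..<s y}" by (auto intro: order.trans less_imp_le)
    then have 1: "card {i. i \<le> length w \<and> i < s y} = s y" by simp
    have "{i. i \<le> length w \<and> (\<not> i < s x \<and> i < s z)} = {s x..<s z}"
      using b[of z] by auto
    then have 2: "card {i. i \<le> length w \<and> (\<not> i < s x \<and> i < s z)} = s z - s x" by simp
    show "(\<not> s z < s x \<and> (card {i. i \<le> length w \<and> (\<not> i < s x \<and> i < s z)} \<le> card {i. i \<le> length w \<and> i < s y} \<and>
     card {i. i \<le> length w \<and> i < s y} \<le> card {i. i \<le> length w \<and> (\<not> i < s x \<and> i < s z)})) \<longleftrightarrow> s x + s y = s z"
      unfolding 1 2 by auto
  qed
qed

text \<open>If a sum is within the range of the variables, so are both summands; bounded quantifiers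
  therefore lose nothing on the visible part of the graph.\<close>

lemma dterm_add:
  assumes "dterm t" "dterm u"
  shows "dterm (\<lambda>w s. t w s + u w s)"
proof -
  have "definable (\<lambda>w s. \<exists>a \<le> length w. \<exists>b \<le> length w. t w (\<lambda>v. s (Suc v)) = a \<and> u w (\<lambda>v. s (Suc v)) = b \<and> a + b = s 0)"
  proof (intro definable_ex definable_conj definable_add_var)
    show "definable (\<lambda>w s. t w (\<lambda>v. s (Suc (Suc (Suc v)))) = s (Suc 0))"
      using definable_rename[of "\<lambda>w s. t w (\<lambda>v. s (Suc v)) = s 0" "case_nat (Suc 0) (\<lambda>v. Suc (Suc (Suc v)))"] assms(1)
      by (simp add: dterm_def)
    show "definable (\<lambda>w s. u w (\<lambda>v. s (Suc (Suc (Suc v)))) = s 0)"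
      using dterm_shift[OF dterm_shift[OF assms(2)]] by (simp add: dterm_def)
  qed
  then show ?thesis unfolding dterm_def
  proof (rule definable_cong)
    fix w :: "'a list" and s :: "nat \<Rightarrow> nat"
    assume "\<And>x. s x \<le> length w"
    from this[of 0] show "(\<exists>a \<le> length w. \<exists>b \<le> length w. t w (\<lambda>v. s (Suc v)) = a \<and> u w (\<lambda>v. s (Suc v)) = b \<and> a + b = s 0) \<longleftrightarrow>
       t w (\<lambda>v. s (Suc v)) + u w (\<lambda>v. s (Suc v)) = s 0" by auto
  qed
qed

lemma definable_less:
  assumes "dterm t" "dterm u" and b: "\<And>w s. (\<And>x. s x \<le> length w) \<Longrightarrow> t w s \<le> length w"
  shows "definable (\<lambda>w s. t w s < u w s)"
proof -
  \<comment> \<open>Negated on the outside, so that a value of \<open>u\<close> beyond the range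
    makes the formula true; this is correct because \<open>t\<close> stays within the range.\<close>
  have "definable (\<lambda>w s. \<not> (\<exists>i \<le> length w. u w s = i \<and> (\<exists>j \<le> length w. t w s = j \<and> \<not> j < i)))"
    using assms(2) dterm_shift[OF assms(1)]
    unfolding dterm_def
    by (intro definable_not definable_ex definable_conj definable_less_var)
  then show ?thesis
  proof (rule definable_cong)
    fix w :: "'a list" and s :: "nat \<Rightarrow> nat"
    assume "\<And>x. s x \<le> length w"
    then have "t w s \<le> length w" using b[of s w] by blast
    then show "(\<not> (\<exists>i \<le> length w. u w s = i \<and> (\<exists>j \<le> length w. t w s = j \<and> \<not> j < i))) \<longleftrightarrow> t w s < u w s"
      by auto
  qed
qed

lemma definable_eq:
  assumes "dterm t" "dterm u" and b: "\<And>w s. (\<And>x. s x \<le> length w) \<Longrightarrow> t w s \<le> length w"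
  shows "definable (\<lambda>w s. t w s = u w s)"
proof (rule definable_cong)
  show "definable (\<lambda>w s. t w s \<le> length w \<and> u w s = t w s)"
    using assms(1) by (rule definable_subst) (use assms(2) in \<open>simp add: dterm_def\<close>)
next
  fix w :: "'a list" and s :: "nat \<Rightarrow> nat"
  assume "\<And>x. s x \<le> length w"
  then have "t w s \<le> length w" using b[of s w] by blast
  then show "(t w s \<le> length w \<and> u w s = t w s) \<longleftrightarrow> t w s = u w s" by auto
qed

definition has_sym :: "'a list \<Rightarrow> nat \<Rightarrow> 'a \<Rightarrow> bool" where
  "has_sym w i a \<longleftrightarrow> i < length w \<and> w ! i = a"

lemma definable_has_sym:
  assumes "dterm t"
  shows "definable (\<lambda>w s. has_sym w (t w s) a)"
proof -
  have "definable (\<lambda>w s. has_sym w (s 0) a)"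
    unfolding definable_def has_sym_def by (rule exI[of _ "IsSym a 0"]) simp
  with assms have "definable (\<lambda>w s. t w s \<le> length w \<and> has_sym w (t w s) a)"
    by (rule definable_subst)
  then show ?thesis by (rule definable_cong) (auto simp: has_sym_def)
qed

lemma dterm_1: "dterm (\<lambda>w s. Suc 0)"
proof -
  have "definable (\<lambda>w s. \<not> 0 = s 0 \<and> (\<forall>i \<le> length w. i < s 0 \<longrightarrow> 0 = i))"
    using dterm_0 by (intro definable_conj definable_not definable_all definable_imp definable_less_var)
      (simp_all add: dterm_def)
  then show ?thesis unfolding dterm_def
  proof (rule definable_cong)
    fix w :: "'a list" and s :: "nat \<Rightarrow> nat"
    assume "\<And>x. s x \<le> length w"
    then have "s 0 \<le> length w" .
    then show "(\<not> 0 = s 0 \<and> (\<forall>i \<le> length w. i < s 0 \<longrightarrow> 0 = i)) \<longleftrightarrow> Suc 0 = s 0"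
      by (cases "s 0 \<le> 1") (auto intro!: exI[of _ "1 :: nat"])
  qed
qed

lemma dterm_const: "dterm (\<lambda>w s. c)"
proof (induction c)
  case (Suc c)
  then show ?case using dterm_add[of "\<lambda>w s. c" "\<lambda>w s. Suc 0"] dterm_1 by simp
qed (rule dterm_0)

lemma dterm_Suc: "dterm t \<Longrightarrow> dterm (\<lambda>w s. Suc (t w s))"
  using dterm_add[of t "\<lambda>w s. Suc 0"] dterm_1 by simp

lemma dterm_sum:
  assumes "finite A" "\<And>a. a \<in> A \<Longrightarrow> dterm (t a)"
  shows "dterm (\<lambda>w s. \<Sum>a \<in> A. t a w s)"
  using assms
proof (induction A)
  case (insert a A)
  then show ?case using dterm_add[of "t a" "\<lambda>w s. \<Sum>a \<in> A. t a w s"] by simp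
qed (simp add: dterm_0)

text \<open>The arguments of \<open>Q\<close> are indexed by an arbitrary type, later that of
  columns, and \<open>f\<close> names the variable holding each of them. This lets a histogram be
  supplied by counts on the word.\<close>

lemma definable_subst_family:
  assumes "finite A"
    and "\<And>f. definable (\<lambda>w s. Q w (\<lambda>a. s (f a)))"
    and "\<And>a. a \<in> A \<Longrightarrow> dterm (t a)"
    and "\<And>a w s. a \<in> A \<Longrightarrow> (\<And>x. s x \<le> length w) \<Longrightarrow> t a w s \<le> length w"
  shows "definable (\<lambda>w s. Q w (\<lambda>a. if a \<in> A then t a w s else s (f a)))"
  using assms(1,3,4)
proof (induction A arbitrary: t f)
  case empty
  then show ?case using assms(2) by simp
next
  case (insert a A)
  \<comment> \<open>The entry \<open>a\<close> is moved to the newly bound variable 0 and all other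
    variables are shifted.\<close>
  let ?f = "(\<lambda>b. Suc (f b))(a := 0)"
  have "definable (\<lambda>w s. t a w s \<le> length w \<and> Q w (\<lambda>b. if b \<in> insert a A then t b w s else s (f b)))"
  proof (rule definable_cong)
    show "definable (\<lambda>w s. t a w s \<le> length w \<and>
        Q w (\<lambda>b. if b \<in> A then t b w s else if b = a then t a w s else s (f b)))"
    proof (rule definable_subst[where P = "\<lambda>w s i. Q w (\<lambda>b. if b \<in> A then t b w s else if b = a then i else s (f b))"])
      show "dterm (t a)" using insert.prems by simp
      have "definable (\<lambda>w s. Q w (\<lambda>b. if b \<in> A then t b w (\<lambda>v. s (Suc v)) else s (?f b)))"
      proof (rule insert.IH)
        show "dterm (\<lambda>w s. t b w (\<lambda>v. s (Suc v)))" if "b \<in> A" for b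
          using that insert.prems(1)[of b] by (simp add: dterm_shift)
        show "t b w (\<lambda>v. s (Suc v)) \<le> length w" if "b \<in> A" "\<And>x. s x \<le> length w" for b w s
          using insert.prems(2)[of b "\<lambda>v. s (Suc v)" w] that by blast
      qed
      moreover have "(\<lambda>b. if b \<in> A then t b w (\<lambda>v. s (Suc v)) else s (?f b)) =
         (\<lambda>b. if b \<in> A then t b w (\<lambda>v. s (Suc v)) else if b = a then s 0 else s (Suc (f b)))" for w s
        by auto
      ultimately show "definable (\<lambda>w s. Q w (\<lambda>b. if b \<in> A then t b w (\<lambda>v. s (Suc v)) else if b = a then s 0 else s (Suc (f b))))"
        by simp
    qed
  next
    fix w :: "'b list" and s :: "nat \<Rightarrow> nat"
    have "(\<lambda>b. if b \<in> A then t b w s else if b = a then t a w s else s (f b)) =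
          (\<lambda>b. if b \<in> insert a A then t b w s else s (f b))" by auto
    then show "(t a w s \<le> length w \<and>
        Q w (\<lambda>b. if b \<in> A then t b w s else if b = a then t a w s else s (f b))) \<longleftrightarrow>
        (t a w s \<le> length w \<and> Q w (\<lambda>b. if b \<in> insert a A then t b w s else s (f b)))" by simp
  qed
  then show ?case
  proof (rule definable_cong)
    fix w :: "'b list" and s :: "nat \<Rightarrow> nat"
    assume "\<And>x. s x \<le> length w"
    then have "t a w s \<le> length w" using insert.prems(2)[of a s w] by blast
    then show "(t a w s \<le> length w \<and> Q w (\<lambda>b. if b \<in> insert a A then t b w s else s (f b))) \<longleftrightarrow>
      Q w (\<lambda>b. if b \<in> insert a A then t b w s else s (f b))" by simp
  qed
qed

text \<open>A quantifier over functions that are free on finitely many entries is one bounded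
  quantifier per entry; with columns as entries it ranges over histograms.\<close>

lemma definable_ex_family:
  assumes "finite A" "\<And>f. definable (\<lambda>w s. Q w (\<lambda>a. s (f a)))"
  shows "definable (\<lambda>w s. \<exists>h. (\<forall>a. a \<notin> A \<longrightarrow> h a = s (f a)) \<and> (\<forall>a \<in> A. h a \<le> length w) \<and> Q w h)"
  using assms(1)
proof (induction A arbitrary: f)
  case empty
  have "(\<exists>h. (\<forall>a. a \<notin> {} \<longrightarrow> h a = s (f a)) \<and> (\<forall>a \<in> {}. h a \<le> length w) \<and> Q w h) \<longleftrightarrow> Q w (\<lambda>a. s (f a))" for w s
  proof -
    have "(\<forall>a. h a = s (f a)) \<longleftrightarrow> h = (\<lambda>a. s (f a))" for h by (auto simp: fun_eq_iff)
    then show ?thesis by simp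
  qed
  then show ?case using assms(2) by simp
next
  case (insert a A)
  let ?f = "(\<lambda>b. Suc (f b))(a := 0)"
  have "definable (\<lambda>w s. \<exists>i \<le> length w. \<exists>h. (\<forall>b. b \<notin> A \<longrightarrow> h b = (if b = a then i else s (f b))) \<and>
      (\<forall>b \<in> A. h b \<le> length w) \<and> Q w h)"
  proof (rule definable_ex)
    have "(\<forall>b. b \<notin> A \<longrightarrow> h b = s (?f b)) \<longleftrightarrow> (\<forall>b. b \<notin> A \<longrightarrow> h b = (if b = a then s 0 else s (Suc (f b))))"
      for h :: "'a \<Rightarrow> nat" and s :: "nat \<Rightarrow> nat"
      by auto
    then show "definable (\<lambda>w s. \<exists>h. (\<forall>b. b \<notin> A \<longrightarrow> h b = (if b = a then s 0 else s (Suc (f b)))) \<and>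
      (\<forall>b \<in> A. h b \<le> length w) \<and> Q w h)"
      by (intro definable_cong[OF insert.IH[of ?f]]) (simp only:)
  qed
  then show ?case
  proof (rule definable_cong)
    fix w :: "'b list" and s :: "nat \<Rightarrow> nat"
    show "(\<exists>i \<le> length w. \<exists>h. (\<forall>b. b \<notin> A \<longrightarrow> h b = (if b = a then i else s (f b))) \<and>
      (\<forall>b \<in> A. h b \<le> length w) \<and> Q w h) \<longleftrightarrow>
      (\<exists>h. (\<forall>b. b \<notin> insert a A \<longrightarrow> h b = s (f b)) \<and> (\<forall>b \<in> insert a A. h b \<le> length w) \<and> Q w h)"
      (is "?L \<longleftrightarrow> ?R")
    proof
      assume ?L
      then obtain i h where h: "i \<le> length w" "\<forall>b. b \<notin> A \<longrightarrow> h b = (if b = a then i else s (f b))"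
        "\<forall>b \<in> A. h b \<le> length w" "Q w h" by blast
      then have "h a = i" using insert.hyps(2) by simp
      then show ?R using h by (intro exI[of _ h] conjI) auto
    next
      assume ?R
      then obtain h where h: "\<forall>b. b \<notin> insert a A \<longrightarrow> h b = s (f b)" "\<forall>b \<in> insert a A. h b \<le> length w" "Q w h"
        by blast
      then show ?L by (intro exI[of _ "h a"] conjI exI[of _ h]) auto
    qed
  qed
qed

section \<open>Column histograms\<close>

text \<open>A column has the type of a partial instance but runs across the instances at one
  coordinate, so \<open>m\<close> is a number of instances and not a dimension.\<close>

definition types :: "nat \<Rightarrow> pinst set" where
  "types m = {\<tau>. length \<tau> = m}"

definition column :: "pinst list \<Rightarrow> nat \<Rightarrow> pinst" where
  "column es i = map (\<lambda>e. e ! i) es"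

definition hist :: "nat \<Rightarrow> pinst list \<Rightarrow> pinst \<Rightarrow> nat" where
  "hist n es \<tau> = card {i. i < n \<and> column es i = \<tau>}"

text \<open>The lookup of \<open>models\<close>, polymorphic so that it selects an instance from a
  list and a component from a column alike.\<close>

definition look :: "nat list \<Rightarrow> 'b list \<Rightarrow> nat \<Rightarrow> 'b" where
  "look xs \<tau> x = the (map_of (zip xs \<tau>) x)"

text \<open>\<open>h\<close> is the marginal of \<open>h'\<close>: forgetting the value of the
  newest instance, at the head of a column, must give back the old counts. The bound
  \<open>N\<close> keeps the new counts within the range of the variables.\<close>

definition extends :: "nat \<Rightarrow> nat \<Rightarrow> (pinst \<Rightarrow> nat) \<Rightarrow> (pinst \<Rightarrow> nat) \<Rightarrow> bool" where
  "extends N m h h' \<longleftrightarrow> (\<forall>\<tau>. \<tau> \<notin> types (Suc m) \<longrightarrow> h' \<tau> = h \<tau>) \<and> (\<forall>\<tau> \<in> types (Suc m). h' \<tau> \<le> N) \<and>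
     (\<forall>\<tau> \<in> types m. h' \<tau> = (\<Sum>v \<in> UNIV. h' (v # \<tau>)))"

text \<open>
  \<open>hsat N xs h \<phi>\<close> evaluates \<open>\<phi>\<close> on instances named by \<open>xs\<close> of which only the number \<open>h \<tau>\<close> of
  coordinates with column \<open>\<tau>\<close> is known.  Values of \<open>h\<close> for columns of different lengths do not
  interfere, so that one function carries the histograms of all quantifier depths.
\<close>

fun hsat :: "nat \<Rightarrow> nat list \<Rightarrow> (pinst \<Rightarrow> nat) \<Rightarrow> fo \<Rightarrow> bool" where
  "hsat N xs h (Subs x y) \<longleftrightarrow>
     (\<forall>\<tau> \<in> {\<tau> \<in> types (length xs). look xs \<tau> x \<noteq> None \<and> look xs \<tau> x \<noteq> look xs \<tau> y}. h \<tau> = 0)"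
| "hsat N xs h (Prec x y) \<longleftrightarrow>
     (\<exists>a \<le> N. (\<Sum>\<tau> \<in> {\<tau> \<in> types (length xs). look xs \<tau> x = None}. h \<tau>) = a \<and>
        (\<exists>b \<le> N. (\<Sum>\<tau> \<in> {\<tau> \<in> types (length xs). look xs \<tau> y = None}. h \<tau>) = b \<and> \<not> a < b))"
| "hsat N xs h (Equal x y) \<longleftrightarrow>
     (\<forall>\<tau> \<in> {\<tau> \<in> types (length xs). look xs \<tau> x \<noteq> look xs \<tau> y}. h \<tau> = 0)"
| "hsat N xs h (Neg \<phi>) \<longleftrightarrow> \<not> hsat N xs h \<phi>"
| "hsat N xs h (Conj \<phi> \<psi>) \<longleftrightarrow> hsat N xs h \<phi> \<and> hsat N xs h \<psi>"
| "hsat N xs h (Disj \<phi> \<psi>) \<longleftrightarrow> hsat N xs h \<phi> \<or> hsat N xs h \<psi>"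
| "hsat N xs h (Exists x \<phi>) \<longleftrightarrow> (\<exists>h'. extends N (length xs) h h' \<and> hsat N (x # xs) h' \<phi>)"
| "hsat N xs h (Forall x \<phi>) \<longleftrightarrow> \<not> (\<exists>h'. extends N (length xs) h h' \<and> \<not> hsat N (x # xs) h' \<phi>)"

section \<open>Histograms determine satisfaction\<close>

lemma finite_types: "finite (types m)"
  using finite_lists_length_eq[of "UNIV :: bool option set" m] by (simp add: types_def)

lemma column_types: "column es i \<in> types (length es)"
  by (simp add: column_def types_def)

lemma look_column:
  assumes "x \<in> set xs" "length es = length xs"
  shows "look xs (column es i) x = look xs es x ! i"
proof -
  obtain e where e: "map_of (zip xs es) x = Some e"
    using assms by (metis map_of_zip_is_Some)
  have "map_of (zip xs (column es i)) = map_option (\<lambda>e. e ! i) \<circ> map_of (zip xs es)"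
    unfolding column_def zip_map2 by (rule map_of_map)
  then show ?thesis using e by (simp add: look_def)
qed

lemma look_in_set:
  assumes "x \<in> set xs" "length es = length xs"
  shows "look xs es x \<in> set es"
proof -
  obtain e where e: "map_of (zip xs es) x = Some e"
    using assms by (metis map_of_zip_is_Some)
  then show ?thesis by (auto simp: look_def dest: map_of_SomeD set_zip_rightD)
qed

lemma hist_eq_0: "hist n es \<tau> = 0 \<longleftrightarrow> (\<forall>i < n. column es i \<noteq> \<tau>)"
  by (auto simp: hist_def)

lemma hist_le: "hist n es \<tau> \<le> n"
  using card_mono[of "{..<n}" "{i. i < n \<and> column es i = \<tau>}"] by (auto simp: hist_def)

lemma card_fibres:
  assumes "finite A" "finite B"
  shows "card {i \<in> A. f i \<in> B} = (\<Sum>b \<in> B. card {i \<in> A. f i = b})"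
proof -
  have "{i \<in> A. f i \<in> B} = (\<Union>b \<in> B. {i \<in> A. f i = b})" by auto
  then show ?thesis using assms by (simp only:) (subst card_UN_disjoint, auto)
qed

lemma hist_marginal:
  assumes "length e = n"
  shows "hist n es \<tau> = (\<Sum>v \<in> UNIV. hist n (e # es) (v # \<tau>))"
proof -
  have "hist n es \<tau> = card {i \<in> {i. i < n \<and> column es i = \<tau>}. e ! i \<in> UNIV}"
    by (simp add: hist_def)
  also have "\<dots> = (\<Sum>v \<in> UNIV. card {i \<in> {i. i < n \<and> column es i = \<tau>}. e ! i = v})"
    by (rule card_fibres) auto
  also have "\<dots> = (\<Sum>v \<in> UNIV. hist n (e # es) (v # \<tau>))"
    unfolding hist_def column_def by (intro sum.cong refl arg_cong[of _ _ card]) auto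
  finally show ?thesis .
qed

lemma card_undef_coords:
  assumes "x \<in> set xs" "length es = length xs" "\<forall>e \<in> set es. length e = n"
  shows "card (undef_coords (look xs es x)) =
    (\<Sum>\<tau> \<in> {\<tau> \<in> types (length xs). look xs \<tau> x = None}. hist n es \<tau>)"
proof -
  have "length (look xs es x) = n" using look_in_set[OF assms(1,2)] assms(3) by blast
  then have "undef_coords (look xs es x) =
      {i \<in> {..<n}. column es i \<in> {\<tau> \<in> types (length xs). look xs \<tau> x = None}}"
    using look_column[OF assms(1,2)] column_types[of es] assms(2) by (auto simp: undef_coords_def)
  also have "card \<dots> = (\<Sum>\<tau> \<in> {\<tau> \<in> types (length xs). look xs \<tau> x = None}. card {i \<in> {..<n}. column es i = \<tau>})"
    by (rule card_fibres) (simp_all add: finite_types)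
  finally show ?thesis by (simp add: hist_def)
qed

text \<open>Choose a subset of the first size for \<open>None\<close>, a subset of the rest for
  \<open>Some True\<close>; what remains has the right size for \<open>Some False\<close>.\<close>

lemma ex_fibres:
  assumes "finite S" "card S = (\<Sum>v \<in> UNIV. c v)"
  shows "\<exists>g :: 'b \<Rightarrow> bool option. \<forall>v. card {i \<in> S. g i = v} = c v"
proof -
  have s: "card S = c None + c (Some True) + c (Some False)"
    using assms(2) by (simp add: UNIV_option_conv UNIV_bool)
  then obtain A where A: "A \<subseteq> S" "card A = c None" 
    using obtain_subset_with_card_n[of "c None" S] by auto
  have fA: "finite A" using A assms(1) finite_subset by blast
  have cSA: "card (S - A) = c (Some True) + c (Some False)"
    using s A fA by (simp add: card_Diff_subset)
  then obtain B where B: "B \<subseteq> S - A" "card B = c (Some True)"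
    using obtain_subset_with_card_n[of "c (Some True)" "S - A"] by auto
  have fB: "finite B" using B assms(1) finite_subset[of B S] by blast
  have cSB: "card (S - A - B) = c (Some False)"
    using cSA B fB by (simp add: card_Diff_subset)
  define g where "g = (\<lambda>i. if i \<in> A then None else Some (i \<in> B))"
  have "{i \<in> S. g i = None} = A" "{i \<in> S. g i = Some True} = B" "{i \<in> S. g i = Some False} = S - A - B"
    using A B by (auto simp: g_def)
  then have "card {i \<in> S. g i = v} = c v" for v
    using A(2) B(2) cSB by (cases v; cases "the v") auto
  then show ?thesis by blast
qed

text \<open>Each class of coordinates with equal column is split by its own function
  \<open>g \<tau>\<close>. The classes partition the coordinates, so these functions combine into a
  single instance.\<close>

lemma extends_realize:
  assumes "extends N (length es) h h'" "\<forall>\<tau> \<in> types (length es). h \<tau> = hist n es \<tau>"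
  shows "\<exists>e. length e = n \<and> (\<forall>\<tau> \<in> types (Suc (length es)). h' \<tau> = hist n (e # es) \<tau>)"
proof -
  let ?S = "\<lambda>\<tau>. {i. i < n \<and> column es i = \<tau>}"
  have "\<exists>g. \<forall>v. card {i \<in> ?S \<tau>. g i = v} = h' (v # \<tau>)" if "\<tau> \<in> types (length es)" for \<tau>
  proof (rule ex_fibres)
    have "\<tau> \<notin> types (Suc (length es))" using that by (simp add: types_def)
    then have "h' \<tau> = hist n es \<tau>" using assms that by (simp add: extends_def)
    then show "card (?S \<tau>) = (\<Sum>v \<in> UNIV. h' (v # \<tau>))"
      using assms(1) that by (simp add: extends_def hist_def)
  qed simp
  then have "\<forall>\<tau> \<in> types (length es). \<exists>g. \<forall>v. card {i \<in> ?S \<tau>. g i = v} = h' (v # \<tau>)" by blast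
  from bchoice[OF this] obtain g where
    g: "\<And>\<tau> v. \<tau> \<in> types (length es) \<Longrightarrow> card {i \<in> ?S \<tau>. g \<tau> i = v} = h' (v # \<tau>)" by blast
  define e where "e = map (\<lambda>i. g (column es i) i) [0..<n]"
  have "h' \<tau> = hist n (e # es) \<tau>" if "\<tau> \<in> types (Suc (length es))" for \<tau>
  proof -
    obtain v \<tau>' where \<tau>: "\<tau> = v # \<tau>'" "\<tau>' \<in> types (length es)"
      using \<open>\<tau> \<in> types (Suc (length es))\<close> by (auto simp: types_def length_Suc_conv)
    have "{i. i < n \<and> column (e # es) i = \<tau>} = {i \<in> ?S \<tau>'. g \<tau>' i = v}"
      unfolding \<tau>(1) by (auto simp: column_def e_def)
    then show ?thesis using g[OF \<tau>(2), of v] \<tau>(1) by (simp add: hist_def)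
  qed
  then show ?thesis by (intro exI[of _ e]) (simp add: e_def)
qed

lemma extends_hist:
  assumes "length e = n" "n \<le> N" "\<forall>\<tau> \<in> types (length es). h \<tau> = hist n es \<tau>"
  shows "\<exists>h'. extends N (length es) h h' \<and> (\<forall>\<tau> \<in> types (Suc (length es)). h' \<tau> = hist n (e # es) \<tau>)"
proof -
  let ?h = "\<lambda>\<tau>. if \<tau> \<in> types (Suc (length es)) then hist n (e # es) \<tau> else h \<tau>"
  have "?h \<tau> = (\<Sum>v \<in> UNIV. ?h (v # \<tau>))" if "\<tau> \<in> types (length es)" for \<tau>
    using that assms(3) hist_marginal[OF assms(1), of es \<tau>] by (simp add: types_def)
  moreover have "?h \<tau> \<le> N" if "\<tau> \<in> types (Suc (length es))" for \<tau>
    using that hist_le[of n "e # es" \<tau>] assms(2) by simp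
  ultimately have "extends N (length es) h ?h" by (auto simp: extends_def)
  then show ?thesis by (intro exI[of _ ?h]) auto
qed

lemma subsumed_hist:
  assumes "x \<in> set xs" "y \<in> set xs" "length es = length xs" "\<forall>e \<in> set es. length e = n"
  shows "subsumed (look xs es x) (look xs es y) \<longleftrightarrow>
    (\<forall>\<tau> \<in> {\<tau> \<in> types (length xs). look xs \<tau> x \<noteq> None \<and> look xs \<tau> x \<noteq> look xs \<tau> y}. hist n es \<tau> = 0)"
proof -
  have "length (look xs es x) = n" using look_in_set assms by blast
  then have "subsumed (look xs es x) (look xs es y) \<longleftrightarrow>
     (\<forall>i < n. look xs (column es i) x \<noteq> None \<longrightarrow> look xs (column es i) x = look xs (column es i) y)"
    using assms by (simp add: subsumed_def look_column)
  then show ?thesis using column_types[of es] assms(3) by (auto simp: hist_eq_0)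
qed

lemma equal_hist:
  assumes "x \<in> set xs" "y \<in> set xs" "length es = length xs" "\<forall>e \<in> set es. length e = n"
  shows "look xs es x = look xs es y \<longleftrightarrow>
    (\<forall>\<tau> \<in> {\<tau> \<in> types (length xs). look xs \<tau> x \<noteq> look xs \<tau> y}. hist n es \<tau> = 0)"
proof -
  have "length (look xs es x) = n" "length (look xs es y) = n" using look_in_set assms by blast+
  then have "look xs es x = look xs es y \<longleftrightarrow>
     (\<forall>i < n. look xs (column es i) x = look xs (column es i) y)"
    using assms by (simp add: list_eq_iff_nth_eq look_column)
  then show ?thesis using column_types[of es] assms(3) by (auto simp: hist_eq_0)
qed

text \<open>In the quantifier cases, \<open>extends_hist\<close> turns an instance into a histogram
  and \<open>extends_realize\<close> goes back. A rebound name is put in front of \<open>xs\<close>,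
  where lookup finds it before its older occurrence.\<close>

lemma sat_hsat:
  assumes "free_vars \<phi> \<subseteq> set xs" "length es = length xs" "\<forall>e \<in> set es. length e = dt_dim T"
    "dt_dim T \<le> N" "\<forall>\<tau> \<in> types (length xs). h \<tau> = hist (dt_dim T) es \<tau>"
  shows "sat T (look xs es) \<phi> \<longleftrightarrow> hsat N xs h \<phi>"
  using assms
proof (induction \<phi> arbitrary: xs es h)
  case (Subs x y)
  then show ?case using subsumed_hist[of x xs y es "dt_dim T"] by auto
next
  case (Equal x y)
  then show ?case using equal_hist[of x xs y es "dt_dim T"] by auto
next
  case (Prec x y)
  let ?S = "\<lambda>x. \<Sum>\<tau> \<in> {\<tau> \<in> types (length xs). look xs \<tau> x = None}. h \<tau>"
  \<comment> \<open>Both sums count undefined coordinates and so are at most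
    \<open>dt_dim T \<le> N\<close>; hence the bounded witnesses in the \<open>Prec\<close> clause
    of \<open>hsat\<close> exist.\<close>
  have S: "card (undef_coords (look xs es z)) = ?S z" "?S z \<le> N" if "z \<in> {x, y}" for z
  proof -
    have z: "z \<in> set xs" using that Prec.prems(1) by auto
    have "?S z = (\<Sum>\<tau> \<in> {\<tau> \<in> types (length xs). look xs \<tau> z = None}. hist (dt_dim T) es \<tau>)"
      by (rule sum.cong) (use Prec.prems(5) in auto)
    then show 1: "card (undef_coords (look xs es z)) = ?S z"
      using card_undef_coords[OF z Prec.prems(2,3)] by (simp only:)
    have "undef_coords (look xs es z) \<subseteq> {..<dt_dim T}"
      using look_in_set[OF z Prec.prems(2)] Prec.prems(3) by (auto simp: undef_coords_def)
    then have "card (undef_coords (look xs es z)) \<le> dt_dim T"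
      using card_mono[of "{..<dt_dim T}"] by fastforce
    then show "?S z \<le> N" using 1 Prec.prems(4) by simp
  qed
  have "hsat N xs h (Prec x y) \<longleftrightarrow> ?S x \<ge> ?S y" using S(2)[of x] S(2)[of y] by (simp add: not_less)
  then show ?case using S(1) by (simp add: less_defined_def)
next
  case (Exists x \<phi>)
  have upd: "(look xs es)(x := e) = look (x # xs) (e # es)" for e
    by (auto simp: look_def fun_eq_iff)
  have IH: "sat T (look (x # xs) (e # es)) \<phi> \<longleftrightarrow> hsat N (x # xs) h' \<phi>"
    if "length e = dt_dim T" "\<forall>\<tau> \<in> types (Suc (length es)). h' \<tau> = hist (dt_dim T) (e # es) \<tau>" for e h'
    using Exists.prems that by (intro Exists.IH) auto
  have h: "\<forall>\<tau> \<in> types (length es). h \<tau> = hist (dt_dim T) es \<tau>" using Exists.prems by simp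
  show ?case unfolding sat.simps hsat.simps upd pinsts_def Exists.prems(2)[symmetric]
    using IH extends_realize[OF _ h] extends_hist[OF _ Exists.prems(4) h] by blast
next
  case (Forall x \<phi>)
  have upd: "(look xs es)(x := e) = look (x # xs) (e # es)" for e
    by (auto simp: look_def fun_eq_iff)
  have IH: "sat T (look (x # xs) (e # es)) \<phi> \<longleftrightarrow> hsat N (x # xs) h' \<phi>"
    if "length e = dt_dim T" "\<forall>\<tau> \<in> types (Suc (length es)). h' \<tau> = hist (dt_dim T) (e # es) \<tau>" for e h'
    using Forall.prems that by (intro Forall.IH) auto
  have h: "\<forall>\<tau> \<in> types (length es). h \<tau> = hist (dt_dim T) es \<tau>" using Forall.prems by simp
  show ?case unfolding sat.simps hsat.simps upd pinsts_def Forall.prems(2)[symmetric]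
    using IH extends_realize[OF _ h] extends_hist[OF _ Forall.prems(4) h] by blast
qed auto

lemma definable_ex_extends:
  assumes "\<And>f. definable (\<lambda>w s. Q w (\<lambda>\<tau>. s (f \<tau>)))"
  shows "definable (\<lambda>w s. \<exists>h'. extends (length w) m (\<lambda>\<tau>. s (f \<tau>)) h' \<and> Q w h')"
proof -
  have "definable (\<lambda>w s. \<exists>h'. (\<forall>\<tau>. \<tau> \<notin> types (Suc m) \<longrightarrow> h' \<tau> = s (f \<tau>)) \<and>
     (\<forall>\<tau> \<in> types (Suc m). h' \<tau> \<le> length w) \<and>
     ((\<forall>\<tau> \<in> types m. h' \<tau> = (\<Sum>v \<in> UNIV. h' (v # \<tau>))) \<and> Q w h'))"
    by (intro definable_ex_family finite_types definable_conj definable_finite_all definable_eq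
        dterm_var dterm_sum assms) auto
  then show ?thesis by (simp add: extends_def conj_assoc)
qed

text \<open>For fixed \<open>\<phi>\<close> and \<open>xs\<close> only finitely many columns occur
  at each depth, so all sums and conjunctions over columns unfold into one formula.\<close>

lemma definable_hsat: "definable (\<lambda>w s. hsat (length w) xs (\<lambda>\<tau>. s (f \<tau>)) \<phi>)"
proof (induction \<phi> arbitrary: xs f)
  case (Subs x y)
  show ?case unfolding hsat.simps
    by (intro definable_finite_all definable_eq dterm_var dterm_0) (auto simp: finite_types)
next
  case (Equal x y)
  show ?case unfolding hsat.simps
    by (intro definable_finite_all definable_eq dterm_var dterm_0) (auto simp: finite_types)
next
  case (Prec x y)
  have t: "dterm (\<lambda>w s. \<Sum>\<tau> \<in> {\<tau> \<in> types (length xs). look xs \<tau> z = None}. s (g \<tau>))" for z g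
    by (intro dterm_sum dterm_var) (simp add: finite_types)
  then have t': "definable (\<lambda>w s. (\<Sum>\<tau> \<in> {\<tau> \<in> types (length xs). look xs \<tau> z = None}. s (Suc (g \<tau>))) = s 0)" for z g
    by (simp add: dterm_def)
  show ?case unfolding hsat.simps
    by (intro definable_ex definable_conj t' definable_not definable_less_var)
next
  case (Exists x \<phi>)
  show ?case unfolding hsat.simps by (intro definable_ex_extends Exists.IH)
next
  case (Forall x \<phi>)
  show ?case unfolding hsat.simps by (intro definable_not definable_ex_extends Forall.IH)
qed (simp_all add: definable_not definable_conj definable_disj)

section \<open>Encodings of decision trees\<close>

definition occ :: "'a set \<Rightarrow> 'a list \<Rightarrow> nat" where
  "occ S u = length (filter (\<lambda>x. x \<in> S) u)"

lemma occ_Nil [simp]: "occ S [] = 0"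
  and occ_Cons [simp]: "occ S (x # u) = of_bool (x \<in> S) + occ S u"
  by (simp_all add: occ_def)

lemma occ_le: "occ S u \<le> length u"
  by (simp add: occ_def)

abbreviation leaf_syms :: "sym set" where "leaf_syms \<equiv> {LeafTrue, LeafFalse}"

text \<open>
  A one-counter automaton for preorder encodings: \<open>m\<close> trees remain to be read, and \<open>b\<close> tells
  whether a tally is admissible.
\<close>

fun acc :: "bool \<Rightarrow> nat \<Rightarrow> sym list \<Rightarrow> bool" where
  "acc b m [] \<longleftrightarrow> m = 0"
| "acc b m (x # u) \<longleftrightarrow> m > 0 \<and>
     (if x = Inner then acc True (Suc m) u
      else if x = Tally then b \<and> acc b m u
      else x \<in> leaf_syms \<and> acc False (m - 1) u)"

definition forest :: "nat \<Rightarrow> sym list \<Rightarrow> bool" where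
  "forest m u \<longleftrightarrow> (\<exists>ts. length ts = m \<and> u = concat (map encode_btree ts))"

lemma encode_btree_neq_Nil [simp]: "encode_btree t \<noteq> []"
  by (cases t) auto

lemma forest_Nil: "forest m [] \<longleftrightarrow> m = 0"
proof
  assume "forest m []"
  then obtain ts where "length ts = m" "[] = concat (map encode_btree ts)"
    by (auto simp: forest_def)
  then show "m = 0" by (cases ts) auto
qed (simp add: forest_def)

text \<open>Reading \<open>Inner\<close> replaces one pending tree by two, so the count rises by
  one; the tallies of the feature are stripped together with it.\<close>

lemma forest_Cons:
  "forest m (x # u) \<longleftrightarrow> m > 0 \<and>
     (if x = Inner then \<exists>i v. u = replicate i Tally @ v \<and> forest (Suc m) v
      else x \<in> leaf_syms \<and> forest (m - 1) u)"
proof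
  assume "forest m (x # u)"
  then obtain ts where ts: "length ts = m" "x # u = concat (map encode_btree ts)"
    by (auto simp: forest_def)
  then obtain t ts' where t: "ts = t # ts'" by (cases ts) auto
  show "m > 0 \<and> (if x = Inner then \<exists>i v. u = replicate i Tally @ v \<and> forest (Suc m) v
      else x \<in> leaf_syms \<and> forest (m - 1) u)"
  proof (cases t)
    case (Leaf b)
    then show ?thesis using ts t by (auto simp: forest_def)
  next
    case (Node i t0 t1)
    have "x = Inner" "u = replicate i Tally @ concat (map encode_btree (t0 # t1 # ts'))"
      using ts t Node by auto
    moreover have "forest (Suc m) (concat (map encode_btree (t0 # t1 # ts')))"
      unfolding forest_def using ts t by (intro exI[of _ "t0 # t1 # ts'"]) auto
    ultimately show ?thesis using ts t by auto
  qed
next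
  assume *: "m > 0 \<and> (if x = Inner then \<exists>i v. u = replicate i Tally @ v \<and> forest (Suc m) v
      else x \<in> leaf_syms \<and> forest (m - 1) u)"
  show "forest m (x # u)"
  proof (cases "x = Inner")
    case True
    then obtain i ts where ts: "u = replicate i Tally @ concat (map encode_btree ts)" "length ts = Suc m"
      using * by (auto simp: forest_def)
    obtain t0 t1 ts' where "ts = t0 # t1 # ts'"
      using ts(2) * by (cases ts; cases "tl ts") auto
    then have "x # u = concat (map encode_btree (Node i t0 t1 # ts'))" "length (Node i t0 t1 # ts') = m"
      using ts True by auto
    then show ?thesis unfolding forest_def by blast
  next
    case False
    then obtain ts where ts: "u = concat (map encode_btree ts)" "length ts = m - 1" "x \<in> leaf_syms"
      using * by (auto simp: forest_def)
    then have "x # u = concat (map encode_btree (Leaf (x = LeafTrue) # ts))"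
      "length (Leaf (x = LeafTrue) # ts) = m" using * by auto
    then show ?thesis unfolding forest_def by blast
  qed
qed

text \<open>With the flag set, the word may first complete a feature. The proviso
  \<open>m > 0\<close> excludes tallies followed by the empty forest, which the automaton rejects;
  behind an \<open>Inner\<close> it always holds.\<close>

lemma acc_forest_aux:
  "(acc False m u \<longleftrightarrow> forest m u) \<and>
   (m > 0 \<longrightarrow> (acc True m u \<longleftrightarrow> (\<exists>i v. u = replicate i Tally @ v \<and> forest m v)))"
proof (induction u arbitrary: m)
  case Nil
  then show ?case by (auto simp: forest_Nil)
next
  case (Cons x u)
  have F: "acc False m (x # u) \<longleftrightarrow> forest m (x # u)"
    using Cons.IH[of "Suc m"] Cons.IH[of "m - 1"] by (auto simp: forest_Cons)
  have T: "acc True m (x # u) \<longleftrightarrow> (\<exists>i v. x # u = replicate i Tally @ v \<and> forest m v)" if "m > 0"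
  proof (cases "x = Tally")
    case True
    have "(\<exists>i v. x # u = replicate i Tally @ v \<and> forest m v) \<longleftrightarrow>
          (\<exists>i v. u = replicate i Tally @ v \<and> forest m v)"
    proof
      assume "\<exists>i v. x # u = replicate i Tally @ v \<and> forest m v"
      then obtain i v where iv: "x # u = replicate i Tally @ v" "forest m v" by blast
      then show "\<exists>i v. u = replicate i Tally @ v \<and> forest m v"
      proof (cases i)
        case 0
        then show ?thesis using iv True by (auto simp: forest_Cons)
      next
        case (Suc j)
        then show ?thesis using iv by (intro exI[of _ j] exI[of _ v]) auto
      qed
    next
      assume "\<exists>i v. u = replicate i Tally @ v \<and> forest m v"
      then obtain i v where iv: "u = replicate i Tally @ v" "forest m v" by blast
      then show "\<exists>i v. x # u = replicate i Tally @ v \<and> forest m v"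
        using True by (intro exI[of _ "Suc i"] exI[of _ v]) auto
    qed
    then show ?thesis using Cons.IH[of m] that True by simp
  next
    case False
    have "(\<exists>i v. x # u = replicate i Tally @ v \<and> forest m v) \<longleftrightarrow> forest m (x # u)"
    proof
      assume "\<exists>i v. x # u = replicate i Tally @ v \<and> forest m v"
      then obtain i v where iv: "x # u = replicate i Tally @ v" "forest m v" by blast
      then show "forest m (x # u)" using False by (cases i) auto
    next
      assume "forest m (x # u)"
      then show "\<exists>i v. x # u = replicate i Tally @ v \<and> forest m v"
        by (intro exI[of _ 0] exI[of _ "x # u"]) auto
    qed
    moreover have "acc True m (x # u) \<longleftrightarrow> acc False m (x # u)" using False by simp
    ultimately show ?thesis using F by (simp only:)
  qed
  show ?case using F T by blast
qed

lemma acc_encode: "acc False 1 u \<longleftrightarrow> (\<exists>t. u = encode_btree t)"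
proof -
  have "acc False 1 u \<longleftrightarrow> forest 1 u" using acc_forest_aux by blast
  also have "\<dots> \<longleftrightarrow> (\<exists>t. u = encode_btree t)"
    by (auto simp: forest_def length_Suc_conv)
  finally show ?thesis .
qed

text \<open>The flag of the automaton is determined by the preceding letter alone, and at position 0
  by its initial value; this makes it definable without following the run.\<close>

definition tally_ok :: "bool \<Rightarrow> sym list \<Rightarrow> nat \<Rightarrow> bool" where
  "tally_ok b u i \<longleftrightarrow> (case i of 0 \<Rightarrow> b | Suc j \<Rightarrow> u ! j \<in> {Inner, Tally})"

lemma tally_ok_0 [simp]: "tally_ok b u 0 = b"
  and tally_ok_Suc: "tally_ok b (x # u) (Suc i) = tally_ok (x \<in> {Inner, Tally}) u i"
  by (auto simp: tally_ok_def split: nat.split)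

text \<open>After a prefix the counter is \<open>m\<close> plus the inner nodes minus the leaves
  read. It must be positive before each letter and 0 at the end: the ballot condition for preorder
  words, written with sums to avoid subtraction.\<close>

lemma acc_index:
  "acc b m u \<longleftrightarrow>
     (\<forall>i < length u. u ! i \<in> {Inner, Tally, LeafTrue, LeafFalse} \<and>
        occ leaf_syms (take i u) < m + occ {Inner} (take i u) \<and> (u ! i = Tally \<longrightarrow> tally_ok b u i)) \<and>
     occ leaf_syms u = m + occ {Inner} u"
proof (induction u arbitrary: b m)
  case (Cons x u)
  have split: "(\<forall>i < length (x # u). P i) \<longleftrightarrow> P 0 \<and> (\<forall>i < length u. P (Suc i))" for P
    by (simp add: All_less_Suc2)
  show ?case
  proof (cases m)
    case 0
    then show ?thesis unfolding split by simp
  next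
    case (Suc k)
    consider "x = Inner" | "x = Tally" "b" | "x = Tally" "\<not> b" | "x \<in> leaf_syms"
      | "x \<notin> {Inner, Tally, LeafTrue, LeafFalse}" by blast
    then show ?thesis
    proof cases
      case 1
      then show ?thesis unfolding split using Suc Cons.IH[of True "Suc m"] by (simp add: tally_ok_Suc)
    next
      case 2
      then show ?thesis unfolding split using Suc Cons.IH[of True m] by (simp add: tally_ok_Suc)
    next
      case 3
      then show ?thesis unfolding split by simp
    next
      case 4
      then show ?thesis unfolding split using Suc Cons.IH[of False k] by (auto simp: tally_ok_Suc)
    next
      case 5
      then show ?thesis unfolding split by auto
    qed
  qed
qed simp

section \<open>Features and their repetition along paths, read off the word\<close>

definition run :: "sym list \<Rightarrow> nat" where
  "run u = length (takeWhile (\<lambda>x. x = Tally) u)"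

lemma run_le: "run u \<le> length u"
  by (simp add: run_def length_takeWhile_le)

lemma run_Nil [simp]: "run [] = 0"
  and run_Cons [simp]: "run (x # u) = (if x = Tally then Suc (run u) else 0)"
  by (simp_all add: run_def)

lemma run_eq:
  "run u = f \<longleftrightarrow> (\<forall>j < f. has_sym u j Tally) \<and> \<not> has_sym u f Tally"
proof (induction u arbitrary: f)
  case Nil
  then show ?case by (cases f) (auto simp: has_sym_def)
next
  case (Cons x u)
  then show ?case by (cases f) (auto simp: has_sym_def All_less_Suc2)
qed

text \<open>The features in the first \<open>m\<close> trees of a sequence of encoded trees.\<close>

fun runs :: "nat \<Rightarrow> sym list \<Rightarrow> nat set" where
  "runs m [] = {}"
| "runs m (x # u) =
     (if m = 0 then {}
      else if x = Inner then insert (run u) (runs (Suc m) u)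
      else if x \<in> leaf_syms then runs (m - 1) u
      else runs m u)"

lemma runs_0 [simp]: "runs 0 u = {}"
  by (cases u) auto

lemma runs_tallies [simp]: "runs m (replicate i Tally @ u) = runs m u"
  by (induction i) auto

lemma run_tallies_encode: "run (replicate i Tally @ encode_btree t @ u) = i"
  by (induction i) (cases t; auto)+

lemma runs_encode: "runs (Suc m) (encode_btree t @ u) = features t \<union> runs m u"
proof (induction t arbitrary: m u)
  case (Node i t0 t1)
  have "runs (Suc m) (encode_btree (Node i t0 t1) @ u) =
    insert i (runs (Suc (Suc m)) (encode_btree t0 @ encode_btree t1 @ u))"
    by (simp add: run_tallies_encode)
  then show ?case by (simp add: Node Un_assoc)
qed auto

text \<open>A position belongs to the first \<open>m\<close> trees iff the counter of pending trees
  has not reached 0 up to it, again a comparison of counts on prefixes.\<close>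

lemma runs_index:
  "f \<in> runs m u \<longleftrightarrow> (\<exists>q < length u. u ! q = Inner \<and> run (drop (Suc q) u) = f \<and>
     (\<forall>r \<le> q. occ leaf_syms (take r u) < m + occ {Inner} (take r u)))"
proof (induction u arbitrary: m)
  case (Cons x u)
  have ex: "(\<exists>i < length (x # u). P i) \<longleftrightarrow> P 0 \<or> (\<exists>i < length u. P (Suc i))" for P
    by (simp add: Ex_less_Suc2)
  have all: "(\<forall>i \<le> Suc q. P i) \<longleftrightarrow> P 0 \<and> (\<forall>i \<le> q. P (Suc i))" for P q
    by (metis Suc_le_mono le0 not0_implies_Suc)
  show ?case
  proof (cases m)
    case 0
    then show ?thesis by auto
  next
    case (Suc k)
    then show ?thesis unfolding ex using Cons.IH[of "Suc m"] Cons.IH[of k] Cons.IH[of m]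
      by (auto simp: all)
  qed
qed simp

text \<open>All paths are free of repetitions iff no node has its feature again in its subtrees.
  These are the \<open>2\<close> trees that follow it in preorder, which turns a condition on paths
  into one on positions.\<close>

fun no_repeat :: "sym list \<Rightarrow> bool" where
  "no_repeat [] \<longleftrightarrow> True"
| "no_repeat (x # u) \<longleftrightarrow> (x = Inner \<longrightarrow> run u \<notin> runs 2 u) \<and> no_repeat u"

lemma no_repeat_tallies [simp]: "no_repeat (replicate i Tally @ u) = no_repeat u"
  by (induction i) auto

text \<open>Nonemptiness is carried along because the feature of a node is collected only if some
  path runs through it.\<close>

lemma features_paths: "features t = (\<Union>p \<in> paths t. set p) \<and> paths t \<noteq> {}"
  by (induction t) auto

lemma no_repeat_encode:
  "no_repeat (encode_btree t @ u) \<longleftrightarrow> (\<forall>p \<in> paths t. distinct p) \<and> no_repeat u"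
proof (induction t arbitrary: u)
  case (Node i t0 t1)
  have "runs 2 (encode_btree t0 @ encode_btree t1 @ u) = features t0 \<union> features t1"
    by (simp add: runs_encode numeral_2_eq_2)
  moreover have "(\<forall>p \<in> paths (Node i t0 t1). distinct p) \<longleftrightarrow>
      i \<notin> features t0 \<union> features t1 \<and> (\<forall>p \<in> paths t0. distinct p) \<and> (\<forall>p \<in> paths t1. distinct p)"
    using features_paths[of t0] features_paths[of t1] by auto
  ultimately show ?case using Node by (simp add: run_tallies_encode)
qed auto

lemma no_repeat_if_no_Inner: "Inner \<notin> set u \<Longrightarrow> no_repeat u"
  by (induction u) auto

lemma no_repeat_index:
  "no_repeat u \<longleftrightarrow> (\<forall>q < length u. u ! q = Inner \<longrightarrow> run (drop (Suc q) u) \<notin> runs 2 (drop (Suc q) u))"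
  by (induction u) (auto simp: All_less_Suc2)

section \<open>Encodings of partial instances\<close>

abbreviation encode_pinsts :: "pinst list \<Rightarrow> sym list" where
  "encode_pinsts es \<equiv> concat (map (\<lambda>e. Sep # encode_pinst e) es)"

text \<open>The recursion is on the number of instances, which is fixed together with the formula,
  so it unfolds into a formula of fixed size; \<open>i \<le> length w\<close> gives the quantifier
  its bounded form.\<close>

fun insts :: "sym list \<Rightarrow> nat \<Rightarrow> nat \<Rightarrow> nat \<Rightarrow> bool" where
  "insts w n q 0 \<longleftrightarrow> length w = q"
| "insts w n q (Suc k) \<longleftrightarrow> has_sym w q Sep \<and>
     (\<forall>i \<le> length w. i < n \<longrightarrow>
        has_sym w (q + Suc i) Zero \<or> has_sym w (q + Suc i) One \<or> has_sym w (q + Suc i) Bot) \<and>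
     insts w n (q + Suc n) k"

text \<open>A block has \<open>Suc n\<close> letters, the separator and \<open>n\<close> values, so
  value \<open>i\<close> of the block at \<open>q\<close> stands at
  \<open>q + Suc i\<close>.\<close>

fun col :: "sym list \<Rightarrow> nat \<Rightarrow> nat \<Rightarrow> pinst \<Rightarrow> nat \<Rightarrow> bool" where
  "col w n q [] i \<longleftrightarrow> True"
| "col w n q (v # \<tau>) i \<longleftrightarrow> has_sym w (q + Suc i) (encode_value v) \<and> col w n (q + Suc n) \<tau> i"

lemma ex_encode_pinst: "set u \<subseteq> {Zero, One, Bot} \<Longrightarrow> \<exists>e. encode_pinst e = u"
proof (induction u)
  case Nil
  then show ?case by (simp add: encode_pinst_def)
next
  case (Cons x u)
  then obtain e where "encode_pinst e = u" by auto
  moreover have "encode_value (if x = Bot then None else Some (x = One)) = x" using Cons.prems by auto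
  ultimately have "encode_pinst ((if x = Bot then None else Some (x = One)) # e) = x # u"
    by (simp add: encode_pinst_def)
  then show ?case ..
qed

lemma insts_iff:
  "insts w n q k \<longleftrightarrow> q \<le> length w \<and>
     (\<exists>es. length es = k \<and> (\<forall>e \<in> set es. length e = n) \<and> drop q w = encode_pinsts es)"
proof (induction k arbitrary: q)
  case 0
  then show ?case by auto
next
  case (Suc k)
  show ?case
  proof
    assume *: "insts w n q (Suc k)"
    then obtain es where es: "q + Suc n \<le> length w" "length es = k" "\<forall>e \<in> set es. length e = n"
        "drop (q + Suc n) w = encode_pinsts es"
      using Suc.IH by auto
    have "w ! q = Sep" using * by (auto simp: has_sym_def)
    have "set (take n (drop (Suc q) w)) \<subseteq> {Zero, One, Bot}"
    proof
      fix x assume "x \<in> set (take n (drop (Suc q) w))"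
      then obtain i where i: "i < n" "x = w ! (q + Suc i)" using es(1) by (auto simp: in_set_conv_nth)
      then have "i \<le> length w" using es(1) by simp
      then show "x \<in> {Zero, One, Bot}" using * i by (auto simp: has_sym_def)
    qed
    then obtain e where e: "encode_pinst e = take n (drop (Suc q) w)" using ex_encode_pinst by blast
    have "length e = n" using arg_cong[OF e, of length] es(1) by (simp add: encode_pinst_def)
    have "drop q w = w ! q # drop (Suc q) w" using es(1) by (simp add: Cons_nth_drop_Suc)
    also have "drop (Suc q) w = take n (drop (Suc q) w) @ drop (q + Suc n) w"
      by (metis append_take_drop_id drop_drop add.commute add_Suc_right)
    finally have "drop q w = encode_pinsts (e # es)" using \<open>w ! q = Sep\<close> e es(4) by simp
    then show "q \<le> length w \<and> (\<exists>es. length es = Suc k \<and> (\<forall>e \<in> set es. length e = n) \<and> drop q w = encode_pinsts es)"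
      using es \<open>length e = n\<close> by (intro conjI exI[of _ "e # es"]) auto
  next
    assume "q \<le> length w \<and> (\<exists>es. length es = Suc k \<and> (\<forall>e \<in> set es. length e = n) \<and> drop q w = encode_pinsts es)"
    then obtain e es where es: "q \<le> length w" "length es = k" "\<forall>e \<in> set es. length e = n" "length e = n"
        "drop q w = Sep # encode_pinst e @ encode_pinsts es"
      by (auto simp: length_Suc_conv)
    have le: "q + Suc n \<le> length w"
      using arg_cong[OF es(5), of length] es(1,4) by (simp add: encode_pinst_def)
    have "drop (q + Suc n) w = drop (Suc n) (drop q w)" by (simp add: add.commute)
    also have "\<dots> = encode_pinsts es" using es(4) by (simp only: es(5)) (simp add: encode_pinst_def)
    finally have I: "insts w n (q + Suc n) k" using Suc.IH es le by blast
    have nth: "w ! (q + i) = (Sep # encode_pinst e @ encode_pinsts es) ! i" for i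
      using es(1) by (simp flip: es(5))
    have S: "has_sym w q Sep" using nth[of 0] le by (simp add: has_sym_def)
    have V: "has_sym w (q + Suc i) (encode_value (e ! i))" if "i < n" for i
      using nth[of "Suc i"] that le es(4) by (simp add: has_sym_def encode_pinst_def nth_append)
    have "has_sym w (q + Suc i) Zero \<or> has_sym w (q + Suc i) One \<or> has_sym w (q + Suc i) Bot"
      if "i < n" for i
      using V[OF that] by (cases "e ! i") (auto split: if_splits)
    then show "insts w n q (Suc k)" using I S by simp
  qed
qed

lemma encode_value_inject: "encode_value a = encode_value b \<longleftrightarrow> a = b"
  by (cases a; cases b) auto

lemma col_column:
  assumes "q \<le> length w" "drop q w = encode_pinsts es" "\<forall>e \<in> set es. length e = n"
    "length \<tau> = length es" "i < n"
  shows "col w n q \<tau> i \<longleftrightarrow> map (\<lambda>e. e ! i) es = \<tau>"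
  using assms(1-4)
proof (induction es arbitrary: q \<tau>)
  case (Cons e es)
  obtain v \<tau>' where \<tau>: "\<tau> = v # \<tau>'" using Cons.prems(4) by (cases \<tau>) auto
  have d: "drop q w = Sep # encode_pinst e @ encode_pinsts es" "length e = n" using Cons.prems by auto
  have le: "q + Suc n \<le> length w"
    using arg_cong[OF d(1), of length] Cons.prems(1) d(2) by (simp add: encode_pinst_def)
  have "drop (q + Suc n) w = drop (Suc n) (drop q w)" by (simp add: add.commute)
  also have "\<dots> = encode_pinsts es" using d(2) by (simp only: d(1)) (simp add: encode_pinst_def)
  finally have IH: "col w n (q + Suc n) \<tau>' i \<longleftrightarrow> map (\<lambda>e. e ! i) es = \<tau>'"
    using Cons.prems le \<tau> by (intro Cons.IH) auto
  have "w ! (q + Suc i) = (Sep # encode_pinst e @ encode_pinsts es) ! Suc i"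
    using Cons.prems(1) by (simp flip: d(1))
  then have "w ! (q + Suc i) = encode_value (e ! i)"
    using assms(5) d(2) by (simp add: encode_pinst_def nth_append)
  then show ?case using IH \<tau> le assms(5) by (auto simp: has_sym_def encode_value_inject)
qed simp

section \<open>Definability of the evaluation problem\<close>

lemma has_sym_drop: "has_sym (drop a w) i x \<longleftrightarrow> has_sym w (a + i) x"
  by (auto simp: has_sym_def)

text \<open>Membership in \<open>S\<close> is spelled as a negated finite conjunction to fit
  \<open>definable_finite_all\<close>.\<close>

lemma occ_take_drop:
  "occ S (take r (drop a w)) = card {i. i \<le> length w \<and> i < r \<and> \<not> (\<forall>x \<in> S. \<not> has_sym w (a + i) x)}"
  unfolding occ_def length_filter_conv_card
  by (intro arg_cong[of _ _ card]) (auto simp: has_sym_def)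

lemma dterm_occ:
  assumes "dterm a" "dterm r" "finite S"
  shows "dterm (\<lambda>w s. occ S (take (r w s) (drop (a w s) w)))"
  unfolding occ_take_drop
  by (intro dterm_card definable_conj definable_less dterm_var dterm_shift assms definable_not
      definable_finite_all definable_has_sym dterm_add) auto

lemma occ_take_drop_le: "occ S (take r (drop a w)) \<le> length w"
  by (rule order_trans[OF occ_le]) simp

lemma dterm_run:
  assumes "dterm b"
  shows "dterm (\<lambda>w s. run (drop (b w s) w))"
proof -
  have "definable (\<lambda>w s. (\<forall>j \<le> length w. j < s 0 \<longrightarrow> has_sym w (b w (\<lambda>v. s (Suc v)) + j) Tally) \<and>
     \<not> has_sym w (b w (\<lambda>v. s (Suc v)) + s 0) Tally)"
    by (intro definable_conj definable_all definable_imp definable_less_var definable_has_sym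
        definable_not dterm_add dterm_var dterm_shift assms)
  then show ?thesis unfolding dterm_def
  proof (rule definable_cong)
    fix w :: "sym list" and s :: "nat \<Rightarrow> nat"
    assume "\<And>x. s x \<le> length w"
    from this[of 0]
    show "((\<forall>j \<le> length w. j < s 0 \<longrightarrow> has_sym w (b w (\<lambda>v. s (Suc v)) + j) Tally) \<and>
        \<not> has_sym w (b w (\<lambda>v. s (Suc v)) + s 0) Tally) \<longleftrightarrow> run (drop (b w (\<lambda>v. s (Suc v))) w) = s 0"
      unfolding run_eq has_sym_drop by (meson less_imp_le_nat order_trans)
  qed
qed

lemma run_drop_le: "run (drop b w) \<le> length w"
  using run_le[of "drop b w"] by simp

lemma definable_runs:
  assumes "dterm b" "dterm f"
  shows "definable (\<lambda>w s. f w s \<in> runs m (drop (b w s) w))"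
proof -
  have "definable (\<lambda>w s. \<exists>q \<le> length w. has_sym w (b w s + q) Inner \<and>
      run (drop (b w s + Suc q) w) = f w s \<and>
      (\<forall>r \<le> length w. r < Suc q \<longrightarrow>
         occ leaf_syms (take r (drop (b w s) w)) < m + occ {Inner} (take r (drop (b w s) w))))"
    by (intro definable_ex definable_conj definable_has_sym dterm_add dterm_var dterm_Suc dterm_const
        definable_eq dterm_run definable_all definable_imp definable_less dterm_occ dterm_shift assms)
      (auto simp: run_drop_le occ_take_drop_le)
  then show ?thesis
  proof (rule definable_cong)
    fix w :: "sym list" and s :: "nat \<Rightarrow> nat"
    show "(\<exists>q \<le> length w. has_sym w (b w s + q) Inner \<and> run (drop (b w s + Suc q) w) = f w s \<and>
      (\<forall>r \<le> length w. r < Suc q \<longrightarrow>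
         occ leaf_syms (take r (drop (b w s) w)) < m + occ {Inner} (take r (drop (b w s) w)))) \<longleftrightarrow>
      f w s \<in> runs m (drop (b w s) w)" (is "?L \<longleftrightarrow> ?R")
    proof
      assume ?L
      then obtain q where q: "q \<le> length w" "has_sym w (b w s + q) Inner"
          "run (drop (b w s + Suc q) w) = f w s"
          "\<forall>r \<le> length w. r < Suc q \<longrightarrow>
             occ leaf_syms (take r (drop (b w s) w)) < m + occ {Inner} (take r (drop (b w s) w))"
        by blast
      show ?R unfolding runs_index
        by (rule exI[of _ q]) (use q in \<open>auto simp: has_sym_def add.commute less_Suc_eq_le\<close>)
    next
      assume ?R
      then obtain q where q: "q < length (drop (b w s) w)" "drop (b w s) w ! q = Inner"
          "run (drop (Suc q) (drop (b w s) w)) = f w s"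
          "\<forall>r \<le> q. occ leaf_syms (take r (drop (b w s) w)) < m + occ {Inner} (take r (drop (b w s) w))"
        unfolding runs_index by blast
      show ?L
        by (rule exI[of _ q]) (use q in \<open>auto simp: has_sym_def add.commute less_Suc_eq_le\<close>)
    qed
  qed
qed

lemma definable_runs_subset:
  assumes "dterm b"
  shows "definable (\<lambda>w s. runs m (drop (b w s) w) \<subseteq> {1..s x})"
proof -
  have "definable (\<lambda>w s. \<forall>f \<le> length w. f \<in> runs m (drop (b w s) w) \<longrightarrow> 0 < f \<and> \<not> s x < f)"
    by (intro definable_all definable_imp definable_conj definable_not definable_runs
        definable_less dterm_var dterm_0 dterm_shift assms) auto
  then show ?thesis
  proof (rule definable_cong)
    fix w :: "sym list" and s :: "nat \<Rightarrow> nat"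
    \<comment> \<open>Every listed feature is the length of a run of tallies in the word, so the
      bounded quantifier misses none.\<close>
    have "f \<le> length w" if "f \<in> runs m (drop (b w s) w)" for f
      using that run_le unfolding runs_index by (metis diff_le_self length_drop order_trans)
    then show "(\<forall>f \<le> length w. f \<in> runs m (drop (b w s) w) \<longrightarrow> 0 < f \<and> \<not> s x < f) \<longleftrightarrow>
      runs m (drop (b w s) w) \<subseteq> {1..s x}"
      by (auto simp: not_less Suc_le_eq)
  qed
qed

lemma definable_no_repeat:
  assumes "dterm b"
  shows "definable (\<lambda>w s. no_repeat (drop (b w s) w))"
proof -
  have "definable (\<lambda>w s. \<forall>q \<le> length w. has_sym w (b w s + q) Inner \<longrightarrow>
      \<not> run (drop (b w s + Suc q) w) \<in> runs 2 (drop (b w s + Suc q) w))"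
    by (intro definable_all definable_imp definable_not definable_has_sym definable_runs dterm_run
        dterm_add dterm_Suc dterm_var dterm_shift assms)
  then show ?thesis
    by (rule definable_cong) (auto simp: no_repeat_index has_sym_def add.commute)
qed

lemma definable_acc:
  assumes "dterm b"
  shows "definable (\<lambda>w s. b w s + s x \<le> length w \<and> acc False 1 (take (s x) (drop (b w s) w)))"
proof -
  have "definable (\<lambda>w s. \<not> length w < b w s + s x \<and>
     (\<forall>i \<le> length w. i < s x \<longrightarrow>
        \<not> (\<forall>a \<in> {Inner, Tally, LeafTrue, LeafFalse}. \<not> has_sym w (b w s + i) a) \<and>
        occ leaf_syms (take i (drop (b w s) w)) < 1 + occ {Inner} (take i (drop (b w s) w)) \<and>
        (has_sym w (b w s + i) Tally \<longrightarrow>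
          (\<exists>j \<le> length w. i = Suc j \<and> \<not> (\<forall>a \<in> {Inner, Tally}. \<not> has_sym w (b w s + j) a)))) \<and>
     occ leaf_syms (take (s x) (drop (b w s) w)) = 1 + occ {Inner} (take (s x) (drop (b w s) w)))"
    by (intro definable_conj definable_not definable_less dterm_length dterm_add dterm_var assms
        definable_all definable_imp definable_less_var definable_finite_all definable_has_sym
        dterm_occ dterm_const definable_ex definable_eq dterm_Suc dterm_shift)
      (auto simp: occ_take_drop_le)
  then show ?thesis
  proof (rule definable_cong)
    fix w :: "sym list" and s :: "nat \<Rightarrow> nat"
    let ?u = "take (s x) (drop (b w s) w)"
    show "(\<not> length w < b w s + s x \<and>
     (\<forall>i \<le> length w. i < s x \<longrightarrow>
        \<not> (\<forall>a \<in> {Inner, Tally, LeafTrue, LeafFalse}. \<not> has_sym w (b w s + i) a) \<and>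
        occ leaf_syms (take i (drop (b w s) w)) < 1 + occ {Inner} (take i (drop (b w s) w)) \<and>
        (has_sym w (b w s + i) Tally \<longrightarrow>
          (\<exists>j \<le> length w. i = Suc j \<and> \<not> (\<forall>a \<in> {Inner, Tally}. \<not> has_sym w (b w s + j) a)))) \<and>
     occ leaf_syms ?u = 1 + occ {Inner} ?u) \<longleftrightarrow>
     b w s + s x \<le> length w \<and> acc False 1 ?u"
    proof (cases "b w s + s x \<le> length w")
      case True
      have ix: "has_sym w (b w s + i) a \<longleftrightarrow> ?u ! i = a" if "i < s x" for i a
        using that True by (auto simp: has_sym_def)
      have tk: "take i ?u = take i (drop (b w s) w)" if "i < s x" for i
        using that by (simp add: min_absorb1)
      have tl: "tally_ok False ?u i \<longleftrightarrow>
          (\<exists>j \<le> length w. i = Suc j \<and> \<not> (\<forall>a \<in> {Inner, Tally}. \<not> has_sym w (b w s + j) a))"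
        if "i < s x" for i
        using that True ix by (cases i) (auto simp: tally_ok_def)
      have len: "length ?u = s x" using True by simp
      have bd: "(\<forall>i \<le> length w. i < s x \<longrightarrow> P i) \<longleftrightarrow> (\<forall>i < s x. P i)" for P
        using True by (meson add_leD2 less_imp_le_nat order_trans)
      show ?thesis unfolding acc_index len bd using True
        by (auto simp: ix tk tl simp del: take_take nth_take)
    qed auto
  qed
qed

lemma definable_insts:
  assumes "dterm n" "dterm q"
  shows "definable (\<lambda>w s. insts w (n w s) (q w s) k)"
  using assms(2)
proof (induction k arbitrary: q)
  case 0
  then show ?case unfolding insts.simps by (intro definable_eq dterm_length) auto
next
  case (Suc k)
  show ?case unfolding insts.simps
    by (intro definable_conj definable_has_sym definable_all definable_imp definable_disj definable_less
        dterm_add dterm_Suc dterm_var Suc.IH Suc.prems dterm_shift assms(1)) auto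
qed

lemma definable_col:
  assumes "dterm n" "dterm q" "dterm i"
  shows "definable (\<lambda>w s. col w (n w s) (q w s) \<tau> (i w s))"
  using assms(2)
proof (induction \<tau> arbitrary: q)
  case Nil
  then show ?case by (simp add: definable_const)
next
  case (Cons v \<tau>)
  show ?case unfolding col.simps
    by (intro definable_conj definable_has_sym dterm_add dterm_Suc Cons.IH Cons.prems assms)
qed

definition word_hist :: "sym list \<Rightarrow> nat \<Rightarrow> nat \<Rightarrow> pinst \<Rightarrow> nat" where
  "word_hist w n q \<tau> = card {i. i \<le> length w \<and> (i < n \<and> col w n q \<tau> i)}"

text \<open>
  Here \<open>n\<close> is the dimension and \<open>l\<close> the length of the encoding of the tree, which starts at
  position \<open>Suc n\<close>.
\<close>

definition eval_word :: "fo \<Rightarrow> nat list \<Rightarrow> sym list \<Rightarrow> nat \<Rightarrow> nat \<Rightarrow> bool" where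
  "eval_word \<phi> xs w n l \<longleftrightarrow>
     (\<forall>i \<le> length w. i < n \<longrightarrow> has_sym w i Tally) \<and> has_sym w n Sep \<and>
     (Suc n + l \<le> length w \<and> acc False 1 (take l (drop (Suc n) w))) \<and>
     runs 1 (drop (Suc n) w) \<subseteq> {1..n} \<and> no_repeat (drop (Suc n) w) \<and>
     insts w n (Suc n + l) (length xs) \<and>
     hsat (length w) xs (\<lambda>\<tau>. if \<tau> \<in> types (length xs) then word_hist w n (Suc n + l) \<tau> else n) \<phi>"

lemma definable_eval_word: "definable (\<lambda>w s. \<exists>n \<le> length w. \<exists>l \<le> length w. eval_word \<phi> xs w n l)"
proof -
  \<comment> \<open>Entries for columns of length \<open>length xs\<close> are counts on the word
    and are substituted as terms; all other entries are filled with the variable \<open>s x\<close>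
    holding the dimension.\<close>
  have h: "definable (\<lambda>w s. hsat (length w) xs
      (\<lambda>\<tau>. if \<tau> \<in> types (length xs) then word_hist w (s x) (Suc (s x) + s y) \<tau> else s x) \<phi>)" for x y
  proof (rule definable_subst_family[where f = "\<lambda>_. x"])
    show "dterm (\<lambda>w s. word_hist w (s x) (Suc (s x) + s y) \<tau>)" for \<tau>
      unfolding word_hist_def
      by (intro dterm_card definable_conj definable_less_var definable_col dterm_add dterm_Suc dterm_var)
    show "word_hist w (s x) (Suc (s x) + s y) \<tau> \<le> length w" if "\<And>x. s x \<le> length w"
      for \<tau> w and s :: "nat \<Rightarrow> nat"
    proof -
      have "word_hist w (s x) (Suc (s x) + s y) \<tau> \<le> card {..<s x}"
        unfolding word_hist_def by (intro card_mono) auto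
      then show ?thesis using that[of x] by simp
    qed
  qed (simp_all add: finite_types definable_hsat)
  show ?thesis unfolding eval_word_def
    by (intro definable_ex definable_conj definable_all definable_imp definable_less_var definable_has_sym
        definable_acc definable_runs_subset definable_no_repeat definable_insts dterm_add dterm_Suc
        dterm_var h)
qed

lemma Eval_iff:
  assumes "free_vars \<phi> \<subseteq> set xs"
  shows "w \<in> Eval \<phi> xs \<longleftrightarrow> (\<exists>n \<le> length w. \<exists>l \<le> length w. eval_word \<phi> xs w n l)"
proof -
  have sat: "models T \<phi> xs es \<longleftrightarrow> hsat (length w) xs
      (\<lambda>\<tau>. if \<tau> \<in> types (length xs) then word_hist w (dt_dim T) q \<tau> else dt_dim T) \<phi>"
    if "q \<le> length w" "dt_dim T \<le> length w" "length es = length xs" "\<forall>e \<in> set es. length e = dt_dim T"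
      "drop q w = encode_pinsts es" for T es q
  proof -
    have "word_hist w (dt_dim T) q \<tau> = hist (dt_dim T) es \<tau>" if "\<tau> \<in> types (length xs)" for \<tau>
    proof -
      have "col w (dt_dim T) q \<tau> i \<longleftrightarrow> column es i = \<tau>" if "i < dt_dim T" for i
        unfolding column_def
        using \<open>q \<le> _\<close> \<open>drop q w = _\<close> \<open>\<forall>e \<in> set es. _\<close> \<open>length es = _\<close> \<open>\<tau> \<in> _\<close> that
        by (intro col_column) (auto simp: types_def)
      then show ?thesis unfolding word_hist_def hist_def
        using \<open>dt_dim T \<le> length w\<close> by (intro arg_cong[of _ _ card]) auto
    qed
    then have "sat T (look xs es) \<phi> \<longleftrightarrow> hsat (length w) xs
      (\<lambda>\<tau>. if \<tau> \<in> types (length xs) then word_hist w (dt_dim T) q \<tau> else dt_dim T) \<phi>"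
      using assms that by (intro sat_hsat) auto
    then show ?thesis by (simp add: models_def look_def[abs_def])
  qed
  \<comment> \<open>\<open>no_repeat\<close> is tested on the whole remainder of the word, so the
    instances behind the tree must not contribute nodes.\<close>
  have no_Inner: "no_repeat (encode_pinsts es)" for es
  proof (rule no_repeat_if_no_Inner)
    have "Inner \<noteq> encode_value v" for v by (cases v) auto
    then show "Inner \<notin> set (encode_pinsts es)" by (auto simp: encode_pinst_def)
  qed
  show ?thesis
  proof
    assume "w \<in> Eval \<phi> xs"
    then obtain T es where T: "w = encode T es" "decision_tree T" "length es = length xs"
        "\<forall>e \<in> set es. length e = dt_dim T" "models T \<phi> xs es"
      by (auto simp: Eval_def pinsts_def)
    let ?n = "dt_dim T" and ?u = "encode_btree (dt_tree T)"
    let ?l = "length ?u"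
    have w: "w = replicate ?n Tally @ Sep # ?u @ encode_pinsts es" using T(1) by (simp add: encode_def)
    have d: "drop (Suc ?n) w = ?u @ encode_pinsts es" by (simp add: w)
    have d': "drop (Suc ?n + ?l) w = encode_pinsts es" by (simp add: w)
    have len: "Suc ?n + ?l \<le> length w" by (simp add: w)
    have "has_sym w i Tally" if "i < ?n" for i using that by (simp add: w has_sym_def nth_append)
    moreover have "has_sym w ?n Sep" by (simp add: w has_sym_def nth_append)
    moreover have "acc False 1 (take ?l (drop (Suc ?n) w))" unfolding acc_encode d by auto
    moreover have "runs 1 (drop (Suc ?n) w) \<subseteq> {1..?n}"
      unfolding d using T(2) by (simp add: runs_encode decision_tree_def)
    moreover have "no_repeat (drop (Suc ?n) w)"
      unfolding d using T(2) no_Inner by (simp add: no_repeat_encode decision_tree_def)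
    moreover have "insts w ?n (Suc ?n + ?l) (length xs)"
      unfolding insts_iff using len d' T by blast
    moreover have "hsat (length w) xs
        (\<lambda>\<tau>. if \<tau> \<in> types (length xs) then word_hist w ?n (Suc ?n + ?l) \<tau> else ?n) \<phi>"
      using sat[OF len _ T(3,4) d'] T(5) len by simp
    ultimately have "eval_word \<phi> xs w ?n ?l" using len by (simp add: eval_word_def)
    then show "\<exists>n \<le> length w. \<exists>l \<le> length w. eval_word \<phi> xs w n l"
      using len by (intro exI[of _ ?n] exI[of _ ?l] conjI) auto
  next
    assume "\<exists>n \<le> length w. \<exists>l \<le> length w. eval_word \<phi> xs w n l"
    then obtain n l where nl: "n \<le> length w" "eval_word \<phi> xs w n l" by blast
    let ?q = "Suc n + l"
    obtain t where t: "take l (drop (Suc n) w) = encode_btree t"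
      using nl(2) acc_encode by (auto simp: eval_word_def)
    have q: "?q \<le> length w" using nl(2) by (simp add: eval_word_def)
    obtain es where es: "length es = length xs" "\<forall>e \<in> set es. length e = n" "drop ?q w = encode_pinsts es"
      using nl(2) by (auto simp: eval_word_def insts_iff)
    define T where "T = \<lparr>dt_dim = n, dt_tree = t\<rparr>"
    have d: "drop (Suc n) w = encode_btree t @ encode_pinsts es"
      using t es(3) by (metis append_take_drop_id drop_drop add.commute)
    have "take (Suc n) w = replicate n Tally @ [Sep]"
    proof (rule nth_equalityI)
      fix i assume "i < length (take (Suc n) w)"
      then have "i < n \<or> i = n" by auto
      then show "take (Suc n) w ! i = (replicate n Tally @ [Sep]) ! i"
        using nl by (auto simp: eval_word_def has_sym_def nth_append)
    qed (use q in auto)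
    then have w: "w = encode T es"
      using d append_take_drop_id[of "Suc n" w] by (simp add: encode_def T_def)
    have "features t \<subseteq> {1..n}" "\<forall>p \<in> paths t. distinct p"
      using nl(2) d by (auto simp: eval_word_def runs_encode no_repeat_encode)
    then have "decision_tree T" by (simp add: decision_tree_def T_def)
    moreover have "models T \<phi> xs es"
    proof -
      have dim: "dt_dim T = n" by (simp add: T_def)
      show ?thesis using sat[of ?q T es, unfolded dim, OF q nl(1) es] nl(2) by (simp only: eval_word_def)
    qed
    ultimately show "w \<in> Eval \<phi> xs"
      unfolding Eval_def using w es
      by (intro CollectI exI[of _ T] exI[of _ es]) (auto simp: pinsts_def T_def)
  qed
qed

theorem theorem3:
  fixes \<phi> :: fo and xs :: "nat list"
  assumes "distinct xs" and "free_vars \<phi> \<subseteq> set xs"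
  shows "Eval \<phi> xs \<in> PTIME"
proof -
  have "Eval \<phi> xs = {w. \<exists>n \<le> length w. \<exists>l \<le> length w. eval_word \<phi> xs w n l}"
    using Eval_iff[OF assms(2)] by blast
  then show ?thesis using definable_PTIME[OF definable_eval_word] by simp
qed

end
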